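(* Let $T$ be an Eulerian cycle-tree of a signed graph $\Sigma$ with a direction $\varepsilon_T$, and let $W$ be a closed walk on $T$ that uses each edge of the block cycles once and each edge of the block paths twice. If $T$ is not a circuit, then $W$ can be divided into the form \[ W=C_0P_1C_1P_2\cdots P_kC_kP_{k+1},\qquad k\ge1, \] satisfying: (i) $\{C_i\}$ is the collection of all end-block cycles of $T$, and the $P_i$ are simple open paths of positive length; (ii) each edge of a non-end-block cycle appears in exactly one of the paths $P_i$, and each edge of a block path appears in exactly two of the paths $P_i$; (iii) each $(C_iP_{i+1}C_{i+1},\varepsilon_T)$, $0\le i\le k$, with $C_{k+1}=C_0$, is a directed circuit of Type III; (iv) $\displaystyle I_T=\frac12\sum_{i=0}^k I_{\Sigma(C_iP_{i+1}C_{i+1})}$.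
   Context: Signed graph $\Sigma=(V,E,\sigma)$: finite graph (loops, multiple edges allowed), $\sigma:E\to\{\pm1\}$. A cycle is a simple closed path (a loop is a cycle); balanced if its edge-sign product is $+1$, else unbalanced. An orientation of a signed subgraph: $\varepsilon(v,e)\in\{\pm1\}$ for $v$ an end-vertex of $e$, with $\varepsilon(u,e)\varepsilon(v,e)=-\sigma(e)$ for $e=uv$; $+1$ = arrow away from $v$. Sink (source): all arrows at the vertex point toward (away from) it. A cut-point is a vertex whose removal increases the number of connected components. Cycle-tree: connected signed subgraph $T$ decomposed into edge-disjoint cycles (block cycles) and vertex-disjoint simple paths (block paths, possibly of length zero) such that the block cycles are all the cycles of $T$, two block cycles share at most one vertex (intersection vertex), each block path meets exactly two block cycles exactly at its two ends (intersection vertices), and every intersection vertex is a cut-point of $T$. Eulerian: each balanced block cycle has an even number, each unbalanced one an odd number, of intersection vertices. An end-block cycle is a block cycle with exactly one intersection vertex. A direction of $T$ is an orientation $\varepsilon_T$ of $T$ with no sink and no source, such that for each block cycle $C$ the restriction to $C$ has a sink or source at each cut-point of $T$ on $C$. $I_T:E\to\mathbb Z$ is $1$ on block-cycle edges, $2$ on block-path edges, $0$ elsewhere. A circuit is an Eulerian cycle-tree not properly containing any Eulerian cycle-tree. A circuit of Type III consists of two vertex-disjoint unbalanced cycles $C_1,C_2$ and a simple path $P$ of positive length whose initial vertex is $C_1\cap P$ and terminal vertex is $C_2\cap P$, written $C_1PC_2$; a directed circuit is a circuit together with (the restriction of $\varepsilon_T$ being) a direction on it. *)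

theory Defs
  imports "Graph_Theory.Digraph_Component"
begin

text \<open>
  Every edge \<open>e\<close> has two ends (half-edges), indexed by \<open>bool\<close>; end \<open>b\<close> is attached to the vertex
  \<open>endpt G e b\<close>. The two ends of a loop are attached to the same vertex but stay distinguishable,
  which is needed because an orientation puts one arrow on each end of a loop.
\<close>

record ('v, 'e) sgraph =
  nodes :: "'v set"
  edges :: "'e set"
  endpt :: "'e \<Rightarrow> bool \<Rightarrow> 'v"
  esign :: "'e \<Rightarrow> int"

definition signed_graph :: "('v, 'e) sgraph \<Rightarrow> bool" where
  "signed_graph G \<longleftrightarrow>
     finite (nodes G) \<and> finite (edges G) \<and>
     (\<forall>e\<in>edges G. (\<forall>b. endpt G e b \<in> nodes G) \<and> esign G e \<in> {1, -1})"

definition signed_subgraph :: "('v, 'e) sgraph \<Rightarrow> ('v, 'e) sgraph \<Rightarrow> bool" where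
  "signed_subgraph H G \<longleftrightarrow>
     signed_graph H \<and> nodes H \<subseteq> nodes G \<and> edges H \<subseteq> edges G \<and>
     (\<forall>e\<in>edges H. endpt H e = endpt G e \<and> esign H e = esign G e)"

definition proper_signed_subgraph :: "('v, 'e) sgraph \<Rightarrow> ('v, 'e) sgraph \<Rightarrow> bool" where
  "proper_signed_subgraph H G \<longleftrightarrow>
     signed_subgraph H G \<and> (nodes H \<noteq> nodes G \<or> edges H \<noteq> edges G)"

definition ends :: "('v, 'e) sgraph \<Rightarrow> 'e set \<Rightarrow> 'v set" where
  "ends G F = {endpt G e b |e b. e \<in> F}"

definition edge_subgraph :: "('v, 'e) sgraph \<Rightarrow> 'e set \<Rightarrow> ('v, 'e) sgraph" where
  "edge_subgraph G F = G\<lparr>nodes := ends G F, edges := F\<rparr>"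

text \<open>
  The dart \<open>(e, b)\<close> traverses \<open>e\<close> from its end \<open>b\<close> to its other end. Walks in the undirected
  graph are the directed arc walks of the digraph of darts; this digraph is symmetric, so its
  strong components are the connected components of the graph.
\<close>

definition darts :: "('v, 'e) sgraph \<Rightarrow> ('v, 'e \<times> bool) pre_digraph" where
  "darts G = \<lparr> verts = nodes G, arcs = edges G \<times> UNIV,
               tail = (\<lambda>(e, b). endpt G e b), head = (\<lambda>(e, b). endpt G e (\<not> b)) \<rparr>"

abbreviation walk :: "('v, 'e) sgraph \<Rightarrow> 'v \<Rightarrow> ('e \<times> bool) list \<Rightarrow> 'v \<Rightarrow> bool" where
  "walk G \<equiv> pre_digraph.awalk (darts G)"

abbreviation simple_path :: "('v, 'e) sgraph \<Rightarrow> 'v \<Rightarrow> ('e \<times> bool) list \<Rightarrow> 'v \<Rightarrow> bool" where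
  "simple_path G \<equiv> pre_digraph.apath (darts G)"

definition walk_edges :: "('e \<times> bool) list \<Rightarrow> 'e set" where
  "walk_edges p = fst ` set p"

text \<open>
  The distinctness of the edges only excludes walking along one edge forth and back.
\<close>

definition simple_closed_path :: "('v, 'e) sgraph \<Rightarrow> ('e \<times> bool) list \<Rightarrow> bool" where
  "simple_closed_path G p \<longleftrightarrow> pre_digraph.cycle (darts G) p \<and> distinct (map fst p)"

definition cycles :: "('v, 'e) sgraph \<Rightarrow> 'e set set" where
  "cycles G = {walk_edges p |p. simple_closed_path G p}"

definition balanced :: "('v, 'e) sgraph \<Rightarrow> 'e set \<Rightarrow> bool" where
  "balanced G C \<longleftrightarrow> (\<Prod>e\<in>C. esign G e) = 1"

text \<open>
  The vertex is removed as a point: a loop at \<open>v\<close> leaves an open arc behind, which counts as a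
  component of its own (an open arc left by any other edge is attached to the component of the
  other end). For loopless graphs this is ordinary vertex deletion. Discarding the loops with the
  vertex would mean that a loop never hangs on a cut-point, so that a negative loop could not
  occur as a block cycle of a Type II or Type III circuit.
\<close>

definition cut_point :: "('v, 'e) sgraph \<Rightarrow> 'v \<Rightarrow> bool" where
  "cut_point G v \<longleftrightarrow>
     v \<in> nodes G \<and>
     card (pre_digraph.sccs_verts (darts G)) <
       card (pre_digraph.sccs_verts (pre_digraph.del_vert (darts G) v)) +
       card {e \<in> edges G. endpt G e False = v \<and> endpt G e True = v}"

definition orientation :: "('v, 'e) sgraph \<Rightarrow> ('e \<Rightarrow> bool \<Rightarrow> int) \<Rightarrow> bool" where
  "orientation G \<epsilon> \<longleftrightarrow>
     (\<forall>e\<in>edges G. (\<forall>b. \<epsilon> e b \<in> {1, -1}) \<and> \<epsilon> e False * \<epsilon> e True = - esign G e)"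

text \<open>
  Sinks and sources are taken with respect to the edges in \<open>F\<close>; the value \<open>1\<close> is an arrow
  pointing away from the vertex.
\<close>

definition sink :: "('v, 'e) sgraph \<Rightarrow> 'e set \<Rightarrow> ('e \<Rightarrow> bool \<Rightarrow> int) \<Rightarrow> 'v \<Rightarrow> bool" where
  "sink G F \<epsilon> v \<longleftrightarrow> (\<forall>e\<in>F. \<forall>b. endpt G e b = v \<longrightarrow> \<epsilon> e b = -1)"

definition source :: "('v, 'e) sgraph \<Rightarrow> 'e set \<Rightarrow> ('e \<Rightarrow> bool \<Rightarrow> int) \<Rightarrow> 'v \<Rightarrow> bool" where
  "source G F \<epsilon> v \<longleftrightarrow> (\<forall>e\<in>F. \<forall>b. endpt G e b = v \<longrightarrow> \<epsilon> e b = 1)"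

text \<open>
  A block path is given as \<open>(u, p)\<close> with initial vertex \<open>u\<close> and list of darts \<open>p\<close>, so \<open>(u, [])\<close>
  is the path of length zero at \<open>u\<close>.
\<close>

type_synonym ('v, 'e) bpath = "'v \<times> ('e \<times> bool) list"

definition path_nodes :: "('v, 'e) sgraph \<Rightarrow> ('v, 'e) bpath \<Rightarrow> 'v set" where
  "path_nodes G = (\<lambda>(u, p). set (pre_digraph.awalk_verts (darts G) u p))"

definition path_edges :: "('v, 'e) bpath \<Rightarrow> 'e set" where
  "path_edges = (\<lambda>(u, p). walk_edges p)"

definition path_init :: "('v, 'e) bpath \<Rightarrow> 'v" where
  "path_init = (\<lambda>(u, p). u)"

definition path_term :: "('v, 'e) sgraph \<Rightarrow> ('v, 'e) bpath \<Rightarrow> 'v" where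
  "path_term G = (\<lambda>(u, p). pre_digraph.awlast (darts G) u p)"

definition intersection_vertices :: "('v, 'e) sgraph \<Rightarrow> ('v, 'e) bpath set \<Rightarrow> 'v set" where
  "intersection_vertices T \<P> =
     {v. \<exists>C\<in>cycles T. \<exists>D\<in>cycles T. C \<noteq> D \<and> v \<in> ends T C \<inter> ends T D} \<union>
     (\<Union>P\<in>\<P>. {path_init P, path_term T P})"

text \<open>
  \<open>\<P>\<close> is the set of block paths. Since the block cycles are required to be all the cycles of
  \<open>T\<close>, they are not a separate parameter. A vertex shared by two block cycles carries a block
  path of length zero; hence no vertex lies on three block cycles.
\<close>

definition cycle_tree :: "('v, 'e) sgraph \<Rightarrow> ('v, 'e) bpath set \<Rightarrow> bool" where
  "cycle_tree T \<P> \<longleftrightarrow>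
     signed_graph T \<and> strongly_connected (darts T) \<and>
     (\<forall>P\<in>\<P>. simple_path T (path_init P) (snd P) (path_term T P)) \<and>
     nodes T = (\<Union>C\<in>cycles T. ends T C) \<union> (\<Union>P\<in>\<P>. path_nodes T P) \<and>
     edges T = (\<Union>C\<in>cycles T. C) \<union> (\<Union>P\<in>\<P>. path_edges P) \<and>
     (\<forall>C\<in>cycles T. \<forall>D\<in>cycles T. C \<noteq> D \<longrightarrow> C \<inter> D = {}) \<and>
     (\<forall>C\<in>cycles T. \<forall>P\<in>\<P>. C \<inter> path_edges P = {}) \<and>
     (\<forall>P\<in>\<P>. \<forall>Q\<in>\<P>. P \<noteq> Q \<longrightarrow> path_nodes T P \<inter> path_nodes T Q = {}) \<and>
     (\<forall>C\<in>cycles T. \<forall>D\<in>cycles T. C \<noteq> D \<longrightarrow> card (ends T C \<inter> ends T D) \<le> 1) \<and>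
     (\<forall>C\<in>cycles T. \<forall>D\<in>cycles T. C \<noteq> D \<longrightarrow> (\<forall>v\<in>ends T C \<inter> ends T D. (v, []) \<in> \<P>)) \<and>
     (\<forall>P\<in>\<P>. \<exists>C D. C \<noteq> D \<and>
        {B \<in> cycles T. ends T B \<inter> path_nodes T P \<noteq> {}} = {C, D} \<and>
        ends T C \<inter> path_nodes T P = {path_init P} \<and>
        ends T D \<inter> path_nodes T P = {path_term T P}) \<and>
     (\<forall>v\<in>intersection_vertices T \<P>. cut_point T v)"

definition eulerian_cycle_tree :: "('v, 'e) sgraph \<Rightarrow> ('v, 'e) bpath set \<Rightarrow> bool" where
  "eulerian_cycle_tree T \<P> \<longleftrightarrow>
     cycle_tree T \<P> \<and>
     (\<forall>C\<in>cycles T.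
        (balanced T C \<longrightarrow> even (card (ends T C \<inter> intersection_vertices T \<P>))) \<and>
        (\<not> balanced T C \<longrightarrow> odd (card (ends T C \<inter> intersection_vertices T \<P>))))"

definition end_block_cycles :: "('v, 'e) sgraph \<Rightarrow> ('v, 'e) bpath set \<Rightarrow> 'e set set" where
  "end_block_cycles T \<P> =
     {C \<in> cycles T. card (ends T C \<inter> intersection_vertices T \<P>) = 1}"

definition direction :: "('v, 'e) sgraph \<Rightarrow> ('e \<Rightarrow> bool \<Rightarrow> int) \<Rightarrow> bool" where
  "direction T \<epsilon> \<longleftrightarrow>
     orientation T \<epsilon> \<and>
     (\<forall>v\<in>nodes T. \<not> sink T (edges T) \<epsilon> v \<and> \<not> source T (edges T) \<epsilon> v) \<and>
     (\<forall>C\<in>cycles T. \<forall>v\<in>ends T C. cut_point T v \<longrightarrow> sink T C \<epsilon> v \<or> source T C \<epsilon> v)"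

definition edge_indicator :: "('v, 'e) sgraph \<Rightarrow> ('v, 'e) bpath set \<Rightarrow> 'e \<Rightarrow> int" where
  "edge_indicator T \<P> e =
     (if \<exists>C\<in>cycles T. e \<in> C then 1 else if \<exists>P\<in>\<P>. e \<in> path_edges P then 2 else 0)"

definition circuit :: "('v, 'e) sgraph \<Rightarrow> ('v, 'e) bpath set \<Rightarrow> bool" where
  "circuit T \<P> \<longleftrightarrow>
     eulerian_cycle_tree T \<P> \<and>
     \<not> (\<exists>T' \<P>'. proper_signed_subgraph T' T \<and> eulerian_cycle_tree T' \<P>')"

text \<open>The subgraph \<open>\<Sigma>(C P D)\<close>.\<close>

definition cpc_graph ::
  "('v, 'e) sgraph \<Rightarrow> 'e set \<Rightarrow> ('v, 'e) bpath \<Rightarrow> 'e set \<Rightarrow> ('v, 'e) sgraph" where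
  "cpc_graph G C P D = edge_subgraph G (C \<union> path_edges P \<union> D)"

definition type_III_circuit ::
  "('v, 'e) sgraph \<Rightarrow> 'e set \<Rightarrow> ('v, 'e) bpath \<Rightarrow> 'e set \<Rightarrow> bool" where
  "type_III_circuit G C P D \<longleftrightarrow>
     circuit (cpc_graph G C P D) {P} \<and>
     C \<in> cycles G \<and> D \<in> cycles G \<and> \<not> balanced G C \<and> \<not> balanced G D \<and>
     ends G C \<inter> ends G D = {} \<and>
     simple_path G (path_init P) (snd P) (path_term G P) \<and> snd P \<noteq> [] \<and>
     ends G C \<inter> path_nodes G P = {path_init P} \<and>
     ends G D \<inter> path_nodes G P = {path_term G P}"

definition directed_type_III_circuit ::
  "('v, 'e) sgraph \<Rightarrow> 'e set \<Rightarrow> ('v, 'e) bpath \<Rightarrow> 'e set \<Rightarrow> ('e \<Rightarrow> bool \<Rightarrow> int) \<Rightarrow> bool" where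
  "directed_type_III_circuit G C P D \<epsilon> \<longleftrightarrow>
     type_III_circuit G C P D \<and> direction (cpc_graph G C P D) \<epsilon>"

end

theory Submission
  imports Defs
begin

text \<open>
  The proof is carried by the tour \<open>W\<close> itself. At an intersection vertex \<open>W\<close> never continues
  on the block cycle it arrives on, and \<open>W\<close> never turns back along an edge: otherwise the rest
  of \<open>W\<close> would close up with an edge to a cycle that overlaps a block cycle or contains an edge of
  a block path. Hence a minimal closed subwalk of \<open>W\<close> is a cycle met by the rest of \<open>T\<close> in a
  single point, that is, a complete traversal of an end-block cycle. Cutting \<open>W\<close> at its successive
  minimal closed subwalks leaves simple paths. The same two properties of \<open>W\<close> make \<open>\<epsilon>\<close>
  coherent along \<open>W\<close>, which gives the directions of the Type III circuits.
\<close>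

section \<open>Walks and cycles in signed graphs\<close>

text \<open>The ban on turning back rests on the direction: the turning vertex is neither a sink nor
  a source, so it is not a dead end, and the tour has to come back to it for another edge. The
  Eulerian condition enters by parity: an end-block cycle has one intersection vertex, hence it is
  unbalanced. That \<open>T\<close> is not a circuit excludes two degenerate shapes. A cycle without
  intersection vertices would be all of \<open>T\<close>, and two end-block cycles with a common
  vertex would together be all of \<open>T\<close>, two unbalanced cycles touching in a point. So
  the end-block cycles are pairwise disjoint, which gives the connecting paths positive length. At
  least two traversals are cut off because the part of the tour after the first one is again a
  nonempty closed walk, and such a walk is never a simple path. Vertices are examined through their
  half-edges rather than their edges, since a loop contributes two half-edges to one vertex.\<close>

lemma darts_simps [simp]:
  "verts (darts G) = nodes G"
  "d \<in> arcs (darts G) \<longleftrightarrow> fst d \<in> edges G"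
  "tail (darts G) d = endpt G (fst d) (snd d)"
  "head (darts G) d = endpt G (fst d) (\<not> snd d)"
  by (cases d; auto simp: darts_def)+

lemma set_subset_arcs_darts [simp]: "set p \<subseteq> arcs (darts G) \<longleftrightarrow> walk_edges p \<subseteq> edges G"
  by (auto simp: walk_edges_def)

lemma walk_edges_simps [simp]:
  "walk_edges [] = {}"
  "walk_edges (d # p) = insert (fst d) (walk_edges p)"
  "walk_edges (p @ q) = walk_edges p \<union> walk_edges q"
  by (auto simp: walk_edges_def)

lemma walk_edges_empty_iff [simp]: "walk_edges p = {} \<longleftrightarrow> p = []"
  by (simp add: walk_edges_def)

lemma set_map_fst_eq_walk_edges: "set (map fst p) = walk_edges p"
  by (simp add: walk_edges_def)

lemma ends_walk_edges:
  "ends G (walk_edges p) = (\<lambda>d. endpt G (fst d) (snd d)) ` set p \<union> (\<lambda>d. endpt G (fst d) (\<not> snd d)) ` set p"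
  (is "?L = ?R")
proof
  show "?L \<subseteq> ?R"
  proof
    fix v assume "v \<in> ?L"
    then obtain d b where d: "d \<in> set p" "v = endpt G (fst d) b"
      by (auto simp: ends_def walk_edges_def)
    show "v \<in> ?R"
      by (cases "b = snd d") (use d in auto)
  qed
  show "?R \<subseteq> ?L"
    by (auto simp: ends_def walk_edges_def) 
qed

lemma ends_Un: "ends G (A \<union> B) = ends G A \<union> ends G B"
  by (auto simp: ends_def)

lemma ends_mono: "A \<subseteq> B \<Longrightarrow> ends G A \<subseteq> ends G B"
  by (auto simp: ends_def)

lemma endsI: "e \<in> F \<Longrightarrow> endpt G e b \<in> ends G F"
  by (auto simp: ends_def)

lemma endsI2: "e \<in> F \<Longrightarrow> endpt G e b = v \<Longrightarrow> v \<in> ends G F"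
  by (auto simp: ends_def)

lemma endsE:
  assumes "v \<in> ends G F"
  obtains e b where "e \<in> F" "endpt G e b = v"
  using assms by (auto simp: ends_def)

text \<open>A dart \<open>(e, b)\<close> doubles as the name of the half-edge of \<open>e\<close> at
  its end \<open>b\<close>. In this reading the half-edge through which \<open>d\<close> arrives is
  \<open>dart_rev d\<close>.\<close>

definition dart_rev :: "'e \<times> bool \<Rightarrow> 'e \<times> bool" where
  "dart_rev d = (fst d, \<not> snd d)"

lemma dart_rev_simps [simp]:
  "fst (dart_rev d) = fst d" "snd (dart_rev d) \<longleftrightarrow> \<not> snd d" "dart_rev (dart_rev d) = d"
  by (simp_all add: dart_rev_def)

lemma dart_or_rev_in_walk:
  assumes "fst h \<in> walk_edges p"
  shows "h \<in> set p \<or> dart_rev h \<in> set p"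
proof -
  obtain d where d: "d \<in> set p" "fst d = fst h" using assms unfolding walk_edges_def by (metis imageE)
  then have "d = h \<or> d = dart_rev h" by (auto simp: dart_rev_def prod_eq_iff)
  with d(1) show ?thesis by auto
qed

locale finite_sgraph =
  fixes T :: "('v, 'e) sgraph"
  assumes signed_graph: "signed_graph T"

lemma fin_digraph_darts: "signed_graph T \<Longrightarrow> fin_digraph (darts T)"
  by unfold_locales (auto simp: signed_graph_def darts_def)

sublocale finite_sgraph \<subseteq> fin_digraph "darts T"
  by (rule fin_digraph_darts[OF signed_graph])

lemma symmetric_darts: "symmetric (darts T)"
  unfolding symmetric_conv
proof
  fix d assume "d \<in> arcs (darts T)"
  then show "\<exists>d'\<in>arcs (darts T). tail (darts T) d = head (darts T) d' \<and> head (darts T) d = tail (darts T) d'"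
    by (intro bexI[of _ "dart_rev d"]) simp_all
qed

lemma symmetric_del_vert_darts: "symmetric (pre_digraph.del_vert (darts T) v)"
  unfolding symmetric_conv
proof
  let ?D = "pre_digraph.del_vert (darts T) v"
  fix d assume "d \<in> arcs ?D"
  then show "\<exists>d'\<in>arcs ?D. tail ?D d = head ?D d' \<and> head ?D d = tail ?D d'"
    by (intro bexI[of _ "dart_rev d"]) (simp_all add: pre_digraph.del_vert_def)
qed

context finite_sgraph
begin

lemma edge_endpt: "e \<in> edges T \<Longrightarrow> endpt T e b \<in> nodes T"
  using signed_graph by (auto simp: signed_graph_def)

lemma ends_subset_nodes: "F \<subseteq> edges T \<Longrightarrow> ends T F \<subseteq> nodes T"
  by (auto simp: ends_def edge_endpt)

lemma awalk_edges: "awalk u p v \<Longrightarrow> walk_edges p \<subseteq> edges T"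
  unfolding awalk_def by simp

lemma path_nodes_eq_ends:
  assumes "awalk u p v" "p \<noteq> []"
  shows "set (awalk_verts u p) = ends T (walk_edges p)"
  using set_awalk_verts_not_Nil[OF assms] by (simp add: ends_walk_edges)

text \<open>Using the first edge again, in either direction, would bring the path back to its
  initial vertex.\<close>

lemma apath_distinct_edges: "apath u p v \<Longrightarrow> distinct (map fst p)"
proof (induction p arbitrary: u)
  case (Cons d p)
  have d: "endpt T (fst d) (snd d) = u" and p: "apath (endpt T (fst d) (\<not> snd d)) p v"
    and u: "u \<notin> set (awalk_verts (endpt T (fst d) (\<not> snd d)) p)"
    using Cons.prems by (auto simp: apath_Cons_iff)
  have "fst d \<notin> walk_edges p"
  proof
    assume *: "fst d \<in> walk_edges p"
    then have "p \<noteq> []" by auto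
    with p u have "u \<notin> ends T (walk_edges p)"
      using path_nodes_eq_ends[of _ p v] by (auto simp: apath_def)
    with * d show False by (metis endsI)
  qed
  then show ?case using Cons.IH[OF p] by (simp add: walk_edges_def)
qed simp

section \<open>Cycles as closed walks and their half-edges at a vertex\<close>

lemma simple_closed_pathI:
  assumes "awalk u p u" "distinct (tl (awalk_verts u p))" "p \<noteq> []" "distinct (map fst p)"
  shows "simple_closed_path T p"
  using assms by (auto simp: simple_closed_path_def cycle_def)

lemma cyclesE:
  assumes "C \<in> cycles T"
  obtains u p where "awalk u p u" "distinct (tl (awalk_verts u p))" "p \<noteq> []"
    "distinct (map fst p)" "C = walk_edges p"
  using assms by (auto simp: cycles_def simple_closed_path_def cycle_def)

lemma cycles_subset: "C \<in> cycles T \<Longrightarrow> C \<subseteq> edges T"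
  by (erule cyclesE) (use awalk_edges in blast)

lemma cycles_nonempty: "C \<in> cycles T \<Longrightarrow> C \<noteq> {}"
  by (erule cyclesE) auto

lemma loop_cycle: "e \<in> edges T \<Longrightarrow> endpt T e b = endpt T e (\<not> b) \<Longrightarrow> {e} \<in> cycles T"
proof -
  assume e: "e \<in> edges T" "endpt T e b = endpt T e (\<not> b)"
  have "simple_closed_path T [(e, b)]"
    by (rule simple_closed_pathI[of "endpt T e b"]) (use e in \<open>auto simp: awalk_simps edge_endpt\<close>)
  then show ?thesis
    unfolding cycles_def by (auto intro!: exI[of _ "[(e, b)]"])
qed

text \<open>The walk shortens to a simple path, and \<open>e\<close> closes it; \<open>e\<close> is
  absent from the path, so no edge repeats. The bound on \<open>B\<close> serves to show that this
  cycle misses a given edge.\<close>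

lemma avoiding_walk_cycle:
  assumes w: "awalk (endpt T e (\<not> b)) p (endpt T e b)" and e: "e \<in> edges T" "e \<notin> walk_edges p"
  shows "\<exists>B\<in>cycles T. e \<in> B \<and> B \<subseteq> insert e (walk_edges p)"
proof -
  define q where "q = awalk_to_apath p"
  have q: "apath (endpt T e (\<not> b)) q (endpt T e b)"
    unfolding q_def by (rule apath_awalk_to_apath[OF w])
  have sub: "walk_edges q \<subseteq> walk_edges p"
    using awalk_to_apath_subset[OF w] by (auto simp: q_def walk_edges_def)
  have "simple_closed_path T ((e, b) # q)"
  proof (rule simple_closed_pathI[of "endpt T e b"])
    show "awalk (endpt T e b) ((e, b) # q) (endpt T e b)"
      using q e by (simp add: awalk_Cons_iff apath_def)
    show "distinct (tl (awalk_verts (endpt T e b) ((e, b) # q)))"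
      using q by (simp add: apath_def)
    show "distinct (map fst ((e, b) # q))"
      using apath_distinct_edges[OF q] sub e(2) by (auto simp: walk_edges_def)
  qed simp
  then have "walk_edges ((e, b) # q) \<in> cycles T"
    unfolding cycles_def by blast
  then show ?thesis using sub by (intro bexI) auto
qed

text \<open>The heads are the vertex list without its first entry, the tails the same list without
  its last entry. Both omitted entries are \<open>u\<close>, so the two lists differ only by a
  rotation.\<close>

lemma closed_walk_inj:
  assumes "awalk u p u" "distinct (tl (awalk_verts u p))" "p \<noteq> []"
  shows "inj_on (tail (darts T)) (set p)" "inj_on (head (darts T)) (set p)"
proof -
  have cas: "cas u p u" using assms(1) by auto
  have h: "tl (awalk_verts u p) = map (head (darts T)) p"
    using awalk_verts_conv'[OF cas] assms(3) by simp
  have t: "awalk_verts u p = map (tail (darts T)) p @ [head (darts T) (last p)]"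
    using awalk_verts_conv[of u p] assms(3) by simp
  have "last (awalk_verts u p) = u" "hd (awalk_verts u p) = u" using assms(1) by auto
  then have "u # tl (awalk_verts u p) = awalk_verts u p" by (metis awalk_verts_non_Nil list.collapse)
  then have eq: "u # map (head (darts T)) p = map (tail (darts T)) p @ [u]"
    using t h \<open>last (awalk_verts u p) = u\<close> by simp
  have "map (head (darts T)) p \<noteq> []" using assms(3) by simp
  then obtain hs z where hs: "map (head (darts T)) p = hs @ [z]" by (metis rev_exhaust)
  with eq have "map (tail (darts T)) p = u # hs" "z = u"
    by (metis append_Cons butlast_snoc last_snoc)+
  then have "distinct (map (tail (darts T)) p)" using assms(2) h hs by simp
  then show "inj_on (tail (darts T)) (set p)" by (simp add: distinct_map)
  show "inj_on (head (darts T)) (set p)" using assms(2) unfolding h by (simp add: distinct_map)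
qed

lemma apath_inj:
  assumes "apath u p v"
  shows "inj_on (tail (darts T)) (set p)" "inj_on (head (darts T)) (set p)"
    "d \<in> set p \<Longrightarrow> head (darts T) d \<noteq> u" "d \<in> set p \<Longrightarrow> tail (darts T) d \<noteq> v"
proof -
  have cas: "cas u p v" and dist: "distinct (awalk_verts u p)" and last: "last (awalk_verts u p) = v"
    and hd: "hd (awalk_verts u p) = u"
    using assms by (auto simp: apath_def)
  show "inj_on (tail (darts T)) (set p)"
    using dist by (auto simp: awalk_verts_conv distinct_map split: if_splits)
  show "inj_on (head (darts T)) (set p)"
    using dist by (auto simp: awalk_verts_conv'[OF cas] distinct_map split: if_splits)
  show "head (darts T) d \<noteq> u" if "d \<in> set p"
  proof
    assume "head (darts T) d = u"
    then have "u \<in> set (map (head (darts T)) p)" using that by force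
    with dist hd that show False by (auto simp: awalk_verts_conv'[OF cas] split: if_splits)
  qed
  show "tail (darts T) d \<noteq> v" if "d \<in> set p"
  proof
    assume "tail (darts T) d = v"
    then have "v \<in> set (map (tail (darts T)) p)" using that by force
    with dist last that show False by (auto simp: awalk_verts_conv split: if_splits)
  qed
qed

text \<open>A half-edge of \<open>p\<close> at \<open>v\<close> is either a dart of \<open>p\<close>
  leaving \<open>v\<close> or the reverse of one entering it, and injectivity allows one of each
  kind. Phrased by injectivity, this applies to closed walks and to paths alike.\<close>

lemma three_half_edges:
  assumes inj: "inj_on (tail (darts T)) (set p)" "inj_on (head (darts T)) (set p)"
    and h: "\<And>h. h \<in> {h1, h2, h3} \<Longrightarrow> fst h \<in> walk_edges p \<and> endpt T (fst h) (snd h) = v"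
  shows "h1 = h2 \<or> h1 = h3 \<or> h2 = h3"
proof -
  have t: "h = k" if "h \<in> set p" "k \<in> set p" "h \<in> {h1,h2,h3}" "k \<in> {h1,h2,h3}" for h k
    using inj_onD[OF inj(1) _ that(1,2)] h[OF that(3)] h[OF that(4)] by simp
  have r: "h = k" if "dart_rev h \<in> set p" "dart_rev k \<in> set p" "h \<in> {h1,h2,h3}" "k \<in> {h1,h2,h3}" for h k
    using inj_onD[OF inj(2) _ that(1,2)] h[OF that(3)] h[OF that(4)] by (simp add: dart_rev_def prod_eq_iff)
  have "h1 \<in> set p \<or> dart_rev h1 \<in> set p" "h2 \<in> set p \<or> dart_rev h2 \<in> set p"
     "h3 \<in> set p \<or> dart_rev h3 \<in> set p"
    using dart_or_rev_in_walk[of h1] dart_or_rev_in_walk[of h2] dart_or_rev_in_walk[of h3] h by simp_all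
  moreover have "h \<in> set p \<Longrightarrow> k \<in> set p \<Longrightarrow> h = k" "dart_rev h \<in> set p \<Longrightarrow> dart_rev k \<in> set p \<Longrightarrow> h = k"
    if "(h, k) \<in> {(h1, h2), (h1, h3), (h2, h3)}" for h k
    using that t[of h k] r[of h k] by auto
  ultimately show ?thesis by blast
qed

text \<open>No dart of a simple path enters its initial vertex or leaves its terminal vertex, so
  only one of the two kinds of half-edge remains there.\<close>

lemma apath_end_half_edge:
  assumes p: "apath u p v" and w: "w = u \<or> w = v"
    and h: "fst h \<in> walk_edges p" "endpt T (fst h) (snd h) = w"
    and k: "fst k \<in> walk_edges p" "endpt T (fst k) (snd k) = w"
  shows "h = k"
proof -
  show ?thesis
  proof (cases "w = u")
    case True
    then have "h \<in> set p" "k \<in> set p"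
      using dart_or_rev_in_walk[OF h(1)] dart_or_rev_in_walk[OF k(1)] apath_inj(3)[OF p] h(2) k(2) by fastforce+
    then show ?thesis using inj_onD[OF apath_inj(1)[OF p]] h(2) k(2) by simp
  next
    case False
    then have "dart_rev h \<in> set p" "dart_rev k \<in> set p"
      using dart_or_rev_in_walk[OF h(1)] dart_or_rev_in_walk[OF k(1)] apath_inj(4)[OF p] h(2) k(2) w by fastforce+
    then have "dart_rev h = dart_rev k"
      using inj_onD[OF apath_inj(2)[OF p], of "dart_rev h" "dart_rev k"] h(2) k(2) by simp
    then show ?thesis by (metis dart_rev_simps(3))
  qed
qed

text \<open>The two are a dart leaving \<open>v\<close> and the reverse of a dart entering
  \<open>v\<close>. They differ because no edge repeats; for a loop they are its two ends.\<close>

lemma cycle_two_half_edges: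
  assumes "C \<in> cycles T" "v \<in> ends T C"
  shows "\<exists>h k. h \<noteq> k \<and> fst h \<in> C \<and> fst k \<in> C \<and> endpt T (fst h) (snd h) = v \<and> endpt T (fst k) (snd k) = v"
proof -
  obtain u p where p: "awalk u p u" "distinct (tl (awalk_verts u p))" "p \<noteq> []"
    "distinct (map fst p)" "C = walk_edges p"
    using assms(1) by (rule cyclesE)
  have cas: "cas u p u" using p by auto
  have v: "v \<in> set (awalk_verts u p)"
    using assms(2) p path_nodes_eq_ends by metis
  have hd: "hd (awalk_verts u p) = u" "last (awalk_verts u p) = u" using p(1) by auto
  have t: "v \<in> set (map (tail (darts T)) p)"
  proof (cases "v = u")
    case True
    then have "v = tail (darts T) (hd p)" using hd(1) p(3) by (simp add: awalk_verts_conv hd_append hd_map)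
    then show ?thesis using p(3) by simp
  next
    case False
    then show ?thesis using v hd(2) p(3) by (auto simp: awalk_verts_conv)
  qed
  have h: "v \<in> set (map (head (darts T)) p)"
  proof (cases "v = u")
    case True
    then have "v = head (darts T) (last p)" using hd(2) p(3) by (simp add: awalk_verts_conv)
    then show ?thesis using p(3) by simp
  next
    case False
    then show ?thesis using v hd(1) p(3) by (auto simp: awalk_verts_conv'[OF cas])
  qed
  from t h obtain d d' where d: "d \<in> set p" "endpt T (fst d) (snd d) = v"
    "d' \<in> set p" "endpt T (fst d') (\<not> snd d') = v" by auto
  have "d \<noteq> dart_rev d'"
  proof
    assume "d = dart_rev d'"
    then have "fst d = fst d'" "d \<noteq> d'" by (auto simp: dart_rev_def prod_eq_iff)
    with d p(4) show False by (auto simp: distinct_map inj_on_def)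
  qed
  with d p(5) show ?thesis
    by (intro exI[of _ d] exI[of _ "dart_rev d'"]) (auto simp: walk_edges_def)
qed

text \<open>The shortest prefix of the vertex list that repeats a vertex \<open>v\<close> is cut at
  both occurrences of \<open>v\<close>. Before the repetition all vertices are distinct, so the part
  up to the first occurrence is a simple path and the part between the two is a simple closed
  walk.\<close>

lemma first_closed_subwalk:
  assumes "awalk x R y" "\<not> apath x R y"
  shows "\<exists>P S R' v. R = P @ S @ R' \<and> apath x P v \<and> awalk v S v \<and> S \<noteq> [] \<and>
    distinct (tl (awalk_verts v S)) \<and> awalk v R' y"
proof -
  have cas: "cas x R y" and "\<not> distinct (awalk_verts x R)"
    using assms by (auto simp: apath_def)
  then obtain xs v ys where 1: "v \<in> set xs" "distinct xs" "awalk_verts x R = xs @ v # ys"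
    unfolding not_distinct_conv_prefix by blast
  from 1(1) obtain as bs where xs: "xs = as @ v # bs" by (meson in_set_conv_decomp)
  have "awalk_verts x R = as @ v # bs @ v # ys" using 1(3) xs by simp
  with cas obtain P R1 where P: "cas x P v" "cas v R1 y" "R = P @ R1" "awalk_verts x P = as @ [v]"
    and "awalk_verts v R1 = v # bs @ v # ys"
    by (rule awalk_decomp_verts)
  then have R1: "awalk_verts v R1 = (v # bs) @ v # ys" by simp
  from P(2) R1 obtain S R' where S: "cas v S v" "cas v R' y" "R1 = S @ R'" "awalk_verts v S = (v # bs) @ [v]"
    by (rule awalk_decomp_verts)
  have v: "v \<in> nodes T"
    using assms(1) 1 by (auto elim!: awalkE')
  have "walk_edges R \<subseteq> edges T" using assms(1) awalk_edges by blast
  then have "awalk x P v" "awalk v S v" "awalk v R' y"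
    using assms(1) P S v by (auto simp: awalk_def)
  moreover have "distinct (awalk_verts x P)" using P(4) 1(2) xs by simp
  moreover have "S \<noteq> []" using S(4) by auto
  moreover have "distinct (tl (awalk_verts v S))" using S(4) 1(2) xs by simp
  ultimately show ?thesis using P(3) S(3) by (auto simp: apath_def)
qed

text \<open>A walk that starts in the vertex set of \<open>F\<close> never leaves it, since each
  edge it takes is in \<open>F\<close> again. This identifies \<open>T\<close> with one or two of
  its cycles when nothing else is attached to them.\<close>

lemma closed_component:
  assumes conn: "strongly_connected (darts T)" and F: "F \<subseteq> edges T" "F \<noteq> {}"
    and cl: "\<And>e b. e \<in> edges T \<Longrightarrow> endpt T e b \<in> ends T F \<Longrightarrow> e \<in> F"
  shows "F = edges T"
proof -
  obtain f where f: "f \<in> F" using F by auto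
  define u where "u = endpt T f True"
  have "awalk w p v \<Longrightarrow> w \<in> ends T F \<Longrightarrow> v \<in> ends T F" for w p v
  proof (induction p arbitrary: w)
    case (Cons d p)
    have d: "fst d \<in> edges T" "endpt T (fst d) (snd d) = w" "awalk (endpt T (fst d) (\<not> snd d)) p v"
      using Cons.prems by (auto simp: awalk_Cons_iff)
    have "fst d \<in> F" using cl d Cons.prems by blast
    then show ?case by (intro Cons.IH[OF d(3)]) (rule endsI)
  qed (simp add: awalk_Nil_iff)
  moreover have "u \<in> ends T F" using f by (auto simp: u_def intro: endsI)
  moreover have "\<exists>p. awalk u p v" if "v \<in> nodes T" for v
    using conn F f that edge_endpt[of f True] unfolding strongly_connected_def reachable_awalk u_def by auto
  ultimately have "nodes T \<subseteq> ends T F" by blast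
  then show ?thesis using cl F(1) edge_endpt by blast
qed

end

section \<open>The local structure of cycle-trees\<close>

locale cycle_tree_graph =
  fixes T :: "('v, 'e) sgraph" and \<P> :: "('v, 'e) bpath set"
  assumes cycle_tree: "cycle_tree T \<P>"

sublocale cycle_tree_graph \<subseteq> finite_sgraph T
  using cycle_tree by unfold_locales (simp add: cycle_tree_def)

context cycle_tree_graph
begin

abbreviation IV :: "'v set" where
  "IV \<equiv> intersection_vertices T \<P>"

text \<open>One fact for each conjunct of \<open>cycle_tree\<close>, numbered in the order of the
  definition.\<close>

lemmas cycle_tree_unfold =
  cycle_tree[unfolded cycle_tree_def, THEN conjunct1]
  cycle_tree[unfolded cycle_tree_def, THEN conjunct2, THEN conjunct1]
  cycle_tree[unfolded cycle_tree_def, THEN conjunct2, THEN conjunct2, THEN conjunct1]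
  cycle_tree[unfolded cycle_tree_def, THEN conjunct2, THEN conjunct2, THEN conjunct2, THEN conjunct1]
  cycle_tree[unfolded cycle_tree_def, THEN conjunct2, THEN conjunct2, THEN conjunct2, THEN conjunct2, THEN conjunct1]
  cycle_tree[unfolded cycle_tree_def, THEN conjunct2, THEN conjunct2, THEN conjunct2, THEN conjunct2, THEN conjunct2, THEN conjunct1]
  cycle_tree[unfolded cycle_tree_def, THEN conjunct2, THEN conjunct2, THEN conjunct2, THEN conjunct2, THEN conjunct2, THEN conjunct2, THEN conjunct1]
  cycle_tree[unfolded cycle_tree_def, THEN conjunct2, THEN conjunct2, THEN conjunct2, THEN conjunct2, THEN conjunct2, THEN conjunct2, THEN conjunct2, THEN conjunct1]
  cycle_tree[unfolded cycle_tree_def, THEN conjunct2, THEN conjunct2, THEN conjunct2, THEN conjunct2, THEN conjunct2, THEN conjunct2, THEN conjunct2, THEN conjunct2, THEN conjunct1]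
  cycle_tree[unfolded cycle_tree_def, THEN conjunct2, THEN conjunct2, THEN conjunct2, THEN conjunct2, THEN conjunct2, THEN conjunct2, THEN conjunct2, THEN conjunct2, THEN conjunct2, THEN conjunct1]
  cycle_tree[unfolded cycle_tree_def, THEN conjunct2, THEN conjunct2, THEN conjunct2, THEN conjunct2, THEN conjunct2, THEN conjunct2, THEN conjunct2, THEN conjunct2, THEN conjunct2, THEN conjunct2, THEN conjunct1]
  cycle_tree[unfolded cycle_tree_def, THEN conjunct2, THEN conjunct2, THEN conjunct2, THEN conjunct2, THEN conjunct2, THEN conjunct2, THEN conjunct2, THEN conjunct2, THEN conjunct2, THEN conjunct2, THEN conjunct2]

lemma path_nodes_conv: "path_nodes T Q = set (awalk_verts (path_init Q) (snd Q))"
  by (cases Q) (simp add: path_nodes_def path_init_def)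

lemma path_edges_conv: "path_edges Q = walk_edges (snd Q)"
  by (cases Q) (simp add: path_edges_def)

lemma connected: "strongly_connected (darts T)"
  using cycle_tree by (simp add: cycle_tree_def)

lemma block_apath: "Q \<in> \<P> \<Longrightarrow> apath (path_init Q) (snd Q) (path_term T Q)"
  using cycle_tree_unfold(3) by blast

lemma nodes_cases:
  assumes "v \<in> nodes T"
  obtains C where "C \<in> cycles T" "v \<in> ends T C" | Q where "Q \<in> \<P>" "v \<in> path_nodes T Q"
  using assms cycle_tree_unfold(4) by blast

lemma edges_cases:
  assumes "e \<in> edges T"
  obtains C where "C \<in> cycles T" "e \<in> C" | Q where "Q \<in> \<P>" "e \<in> path_edges Q"
  using assms cycle_tree_unfold(5) by blast

lemma cycles_eqI: "C \<in> cycles T \<Longrightarrow> D \<in> cycles T \<Longrightarrow> e \<in> C \<Longrightarrow> e \<in> D \<Longrightarrow> C = D"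
  using cycle_tree_unfold(6) by blast

lemma cycle_path_disjoint: "C \<in> cycles T \<Longrightarrow> Q \<in> \<P> \<Longrightarrow> e \<in> C \<Longrightarrow> e \<in> path_edges Q \<Longrightarrow> False"
  using cycle_tree_unfold(7) by blast

lemma path_nodes_eqI: "Q \<in> \<P> \<Longrightarrow> R \<in> \<P> \<Longrightarrow> v \<in> path_nodes T Q \<Longrightarrow> v \<in> path_nodes T R \<Longrightarrow> Q = R"
  using cycle_tree_unfold(8) by blast

lemma shared_vertex: "C \<in> cycles T \<Longrightarrow> D \<in> cycles T \<Longrightarrow> C \<noteq> D \<Longrightarrow> v \<in> ends T C \<Longrightarrow> v \<in> ends T D \<Longrightarrow> (v, []) \<in> \<P>"
  using cycle_tree_unfold(10) by blast

lemma block_path_cycles: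
  assumes "Q \<in> \<P>"
  obtains C D where "C \<noteq> D" "C \<in> cycles T" "D \<in> cycles T"
    "\<And>B v. B \<in> cycles T \<Longrightarrow> v \<in> ends T B \<Longrightarrow> v \<in> path_nodes T Q \<Longrightarrow> B = C \<or> B = D"
    "\<And>v. v \<in> path_nodes T Q \<Longrightarrow> v \<in> ends T C \<longleftrightarrow> v = path_init Q"
    "\<And>v. v \<in> path_nodes T Q \<Longrightarrow> v \<in> ends T D \<longleftrightarrow> v = path_term T Q"
proof -
  obtain C D where *: "C \<noteq> D" and eq: "{B \<in> cycles T. ends T B \<inter> path_nodes T Q \<noteq> {}} = {C, D}"
    and C: "ends T C \<inter> path_nodes T Q = {path_init Q}" and D: "ends T D \<inter> path_nodes T Q = {path_term T Q}"
    using cycle_tree_unfold(11)[THEN bspec, OF assms] by (elim exE conjE)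
  have iff: "B \<in> cycles T \<and> ends T B \<inter> path_nodes T Q \<noteq> {} \<longleftrightarrow> B = C \<or> B = D" for B
  proof -
    have "B \<in> {B \<in> cycles T. ends T B \<inter> path_nodes T Q \<noteq> {}} \<longleftrightarrow> B \<in> {C, D}" unfolding eq ..
    then show ?thesis by (simp only: mem_Collect_eq insert_iff empty_iff simp_thms)
  qed
  show thesis
  proof (rule that[OF *])
    show "C \<in> cycles T" "D \<in> cycles T" using iff by metis+
    show "B = C \<or> B = D" if "B \<in> cycles T" "v \<in> ends T B" "v \<in> path_nodes T Q" for B v
      using that by (subst iff[symmetric]) auto
    fix v assume v: "v \<in> path_nodes T Q"
    have "v \<in> ends T C \<inter> path_nodes T Q \<longleftrightarrow> v \<in> {path_init Q}" unfolding C ..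
    with v show "v \<in> ends T C \<longleftrightarrow> v = path_init Q" by simp
    have "v \<in> ends T D \<inter> path_nodes T Q \<longleftrightarrow> v \<in> {path_term T Q}" unfolding D ..
    with v show "v \<in> ends T D \<longleftrightarrow> v = path_term T Q" by simp
  qed
qed

lemma IV_cut_point: "v \<in> IV \<Longrightarrow> cut_point T v"
  using cycle_tree_unfold(12) by blast

lemma path_ends_in_nodes:
  assumes "Q \<in> \<P>"
  shows "path_init Q \<in> path_nodes T Q" "path_term T Q \<in> path_nodes T Q"
  using hd_in_awalk_verts(2)[OF block_apath[OF assms]] by (auto simp: path_nodes_conv path_term_def path_init_def split_beta)

lemma block_path_end_cycles:
  assumes "Q \<in> \<P>"
  obtains C D where "C \<noteq> D" "C \<in> cycles T" "D \<in> cycles T" "path_init Q \<in> ends T C" "path_term T Q \<in> ends T D"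
proof (rule block_path_cycles[OF assms])
  fix C D assume CD: "C \<noteq> D" "C \<in> cycles T" "D \<in> cycles T"
    and iff: "\<And>v. v \<in> path_nodes T Q \<Longrightarrow> v \<in> ends T C \<longleftrightarrow> v = path_init Q"
      "\<And>v. v \<in> path_nodes T Q \<Longrightarrow> v \<in> ends T D \<longleftrightarrow> v = path_term T Q"
  show thesis
    by (rule that[OF CD]) (simp_all add: iff path_ends_in_nodes[OF assms])
qed

lemma path_edges_ends:
  assumes "Q \<in> \<P>" "e \<in> path_edges Q"
  shows "endpt T e b \<in> path_nodes T Q"
proof -
  have "snd Q \<noteq> []" using assms(2) by (auto simp: path_edges_conv)
  then have "path_nodes T Q = ends T (path_edges Q)"
    using path_nodes_eq_ends block_apath[OF assms(1)] by (auto simp: apath_def path_nodes_conv path_edges_conv)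
  then show ?thesis using assms(2) by (auto intro: endsI)
qed

text \<open>A vertex shared by two cycles is the end of a block path as well, namely of the path of
  length zero that it carries.\<close>

lemma IV_iff: "v \<in> IV \<longleftrightarrow> (\<exists>Q\<in>\<P>. v = path_init Q \<or> v = path_term T Q)"
proof
  assume "v \<in> IV"
  then consider C D where "C \<in> cycles T" "D \<in> cycles T" "C \<noteq> D" "v \<in> ends T C" "v \<in> ends T D"
    | "\<exists>Q\<in>\<P>. v = path_init Q \<or> v = path_term T Q"
    unfolding intersection_vertices_def by auto
  then show "\<exists>Q\<in>\<P>. v = path_init Q \<or> v = path_term T Q"
  proof cases
    case 1
    from shared_vertex[OF 1] show ?thesis by (intro bexI[of _ "(v, [])"]) (auto simp: path_init_def)
  qed
qed (auto simp: intersection_vertices_def)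

lemma cycle_meets_path:
  assumes "C \<in> cycles T" "Q \<in> \<P>" "v \<in> ends T C" "v \<in> path_nodes T Q"
  shows "v \<in> IV"
proof -
  obtain C1 D1 where "C1 \<noteq> D1" "C1 \<in> cycles T" "D1 \<in> cycles T"
    and B: "\<And>B v. B \<in> cycles T \<Longrightarrow> v \<in> ends T B \<Longrightarrow> v \<in> path_nodes T Q \<Longrightarrow> B = C1 \<or> B = D1"
    and C1: "\<And>v. v \<in> path_nodes T Q \<Longrightarrow> v \<in> ends T C1 \<longleftrightarrow> v = path_init Q"
    and D1: "\<And>v. v \<in> path_nodes T Q \<Longrightarrow> v \<in> ends T D1 \<longleftrightarrow> v = path_term T Q"
    using block_path_cycles[OF assms(2)] by blast
  have "v = path_init Q \<or> v = path_term T Q"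
    using B[OF assms(1,3,4)] C1[OF assms(4)] D1[OF assms(4)] assms(3) by auto
  then show ?thesis using IV_iff assms(2) by blast
qed

text \<open>An edge outside of \<open>C\<close> lies on another cycle, which then shares
  \<open>v\<close> with \<open>C\<close>, or on a block path, which touches cycles only at its ends.
  Contrapositively, away from intersection vertices a cycle contains every edge at its
  vertices.\<close>

lemma cycle_leaves_at_IV:
  assumes "C \<in> cycles T" "v \<in> ends T C" "e \<in> edges T" "endpt T e b = v" "e \<notin> C"
  shows "v \<in> IV"
  using assms(3)
proof (rule edges_cases)
  fix D assume D: "D \<in> cycles T" "e \<in> D"
  have "v \<in> ends T D" by (rule endsI2[OF D(2) assms(4)])
  moreover have "C \<noteq> D" using D(2) assms(5) by blast
  ultimately have "(v, []) \<in> \<P>" using shared_vertex[OF assms(1) D(1) _ assms(2)] by blast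
  then show "v \<in> IV" unfolding IV_iff by (intro bexI[of _ "(v, [])"]) (simp_all add: path_init_def)
next
  fix Q assume "Q \<in> \<P>" "e \<in> path_edges Q"
  from path_edges_ends[OF this, of b] have "v \<in> path_nodes T Q" unfolding assms(4) .
  then show "v \<in> IV" by (rule cycle_meets_path[OF assms(1) \<open>Q \<in> \<P>\<close> assms(2)])
qed

text \<open>All edges at \<open>v\<close> belong to a single cycle or to a single block path;
  \<open>p\<close> is a walk around that cycle or along that path. Together with
  \<open>three_half_edges\<close> this leaves at most two half-edges at \<open>v\<close>.\<close>

lemma non_IV_edges:
  assumes "v \<in> nodes T" "v \<notin> IV"
  obtains p where "inj_on (tail (darts T)) (set p)" "inj_on (head (darts T)) (set p)"
    "\<And>e b. e \<in> edges T \<Longrightarrow> endpt T e b = v \<Longrightarrow> e \<in> walk_edges p"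
proof (cases "\<exists>C\<in>cycles T. v \<in> ends T C")
  case True
  then obtain C where C: "C \<in> cycles T" "v \<in> ends T C" by blast
  from C(1) obtain u p where p: "awalk u p u" "distinct (tl (awalk_verts u p))" "p \<noteq> []" "C = walk_edges p"
    by (elim cyclesE)
  show thesis
    by (rule that[OF closed_walk_inj[OF p(1-3)]]) (use cycle_leaves_at_IV[OF C] assms(2) p(4) in blast)
next
  case False
  with assms(1) obtain Q where Q: "Q \<in> \<P>" "v \<in> path_nodes T Q"
    using nodes_cases by metis
  show thesis
  proof (rule that[OF apath_inj(1,2)[OF block_apath[OF Q(1)]]])
    fix e b assume e: "e \<in> edges T" "endpt T e b = v"
    from e(1) show "e \<in> walk_edges (snd Q)"
    proof (cases rule: edges_cases)
      case (1 C)
      with False endsI2[OF _ e(2)] show ?thesis by blast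
    next
      case (2 R)
      with path_nodes_eqI[OF Q(1) 2(1) Q(2)] path_edges_ends[OF 2] e(2) show ?thesis
        by (auto simp: path_edges_conv)
    qed
  qed
qed

text \<open>Block paths are vertex-disjoint, so exactly one of them contains \<open>v\<close>. If it
  has length zero, two cycles touch at \<open>v\<close> and contain all its edges. If its length is
  positive, its ends differ, so only one cycle passes through \<open>v\<close>, and the path adds a
  single half-edge \<open>h\<close>.\<close>

lemma IV_edges:
  assumes "v \<in> IV"
  obtains C D where "C \<in> cycles T" "D \<in> cycles T" "C \<noteq> D" "v \<in> ends T C" "v \<in> ends T D"
      "\<And>e b. e \<in> edges T \<Longrightarrow> endpt T e b = v \<Longrightarrow> e \<in> C \<union> D"
  | C h where "C \<in> cycles T" "v \<in> ends T C" "fst h \<in> edges T" "endpt T (fst h) (snd h) = v"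
      "\<And>B. B \<in> cycles T \<Longrightarrow> fst h \<notin> B"
      "\<And>k. fst k \<in> edges T \<Longrightarrow> endpt T (fst k) (snd k) = v \<Longrightarrow> fst k \<in> C \<or> k = h"
proof -
  obtain Q where Q: "Q \<in> \<P>" and v: "v = path_init Q \<or> v = path_term T Q"
    using assms IV_iff by blast
  have vQ: "v \<in> path_nodes T Q" using v path_ends_in_nodes[OF Q] by auto
  obtain C D where CD: "C \<noteq> D" "C \<in> cycles T" "D \<in> cycles T"
    and B: "\<And>B v. B \<in> cycles T \<Longrightarrow> v \<in> ends T B \<Longrightarrow> v \<in> path_nodes T Q \<Longrightarrow> B = C \<or> B = D"
    and C: "\<And>v. v \<in> path_nodes T Q \<Longrightarrow> v \<in> ends T C \<longleftrightarrow> v = path_init Q"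
    and D: "\<And>v. v \<in> path_nodes T Q \<Longrightarrow> v \<in> ends T D \<longleftrightarrow> v = path_term T Q"
    using block_path_cycles[OF Q] by blast
  have only: "B = C \<or> B = D" if "B \<in> cycles T" "v \<in> ends T B" for B
    using B[OF that vQ] .
  show thesis
  proof (cases "snd Q = []")
    case True
    then have "path_term T Q = path_init Q" using block_apath[OF Q] by (simp add: apath_Nil_iff)
    then have vv: "v \<in> ends T C" "v \<in> ends T D" using C[OF vQ] D[OF vQ] v by auto
    show thesis
    proof (rule that(1)[OF CD(2,3,1) vv])
      fix e b assume e: "e \<in> edges T" "endpt T e b = v"
      from e(1) show "e \<in> C \<union> D"
      proof (cases rule: edges_cases)
        case (1 B)
        then show ?thesis using only[OF 1(1) endsI2[OF 1(2) e(2)]] by auto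
      next
        case (2 R)
        then have "R = Q" using path_nodes_eqI[OF 2(1) Q _ vQ] path_edges_ends[OF 2] e(2) by blast
        with 2(2) True show ?thesis by (simp add: path_edges_conv)
      qed
    qed
  next
    case False
    then have ne: "path_init Q \<noteq> path_term T Q"
      using apath_nonempty_ends[OF block_apath[OF Q]] by blast
    have "\<exists>B\<in>cycles T. v \<in> ends T B \<and> (\<forall>B'\<in>cycles T. v \<in> ends T B' \<longrightarrow> B' = B)"
    proof (cases "v = path_init Q")
      case True
      then have "v \<in> ends T C" "v \<notin> ends T D" using C[OF vQ] D[OF vQ] ne by auto
      then show ?thesis using only CD(2) by blast
    next
      case False
      then have "v \<in> ends T D" "v \<notin> ends T C" using C[OF vQ] D[OF vQ] v by auto
      then show ?thesis using only CD(3) by blast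
    qed
    then obtain B where B: "B \<in> cycles T" "v \<in> ends T B" "\<And>B'. B' \<in> cycles T \<Longrightarrow> v \<in> ends T B' \<Longrightarrow> B' = B"
      by blast
    have "v \<in> ends T (path_edges Q)"
      using vQ path_nodes_eq_ends[OF awalkI_apath[OF block_apath[OF Q]] False]
      by (simp add: path_nodes_conv path_edges_conv)
    then obtain e b where h: "e \<in> path_edges Q" "endpt T e b = v" by (rule endsE)
    have "e \<in> edges T" using h(1) awalk_edges[OF awalkI_apath[OF block_apath[OF Q]]] by (auto simp: path_edges_conv)
    show thesis
    proof (rule that(2)[of B "(e, b)"])
      fix k :: "'e \<times> bool" assume k: "fst k \<in> edges T" "endpt T (fst k) (snd k) = v"
      from k(1) show "fst k \<in> B \<or> k = (e, b)"
      proof (cases rule: edges_cases)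
        case (1 B')
        then show ?thesis using B(3)[OF 1(1) endsI2[OF 1(2) k(2)]] by auto
      next
        case (2 R)
        then have "R = Q" using path_nodes_eqI[OF 2(1) Q _ vQ] path_edges_ends[OF 2] k(2) by blast
        then have "k = (e, b)"
          using apath_end_half_edge[OF block_apath[OF Q] v, of k "(e, b)"] h k(2) 2(2)
          by (simp add: path_edges_conv)
        then show ?thesis ..
      qed
    next
      show "fst (e, b) \<notin> B'" if "B' \<in> cycles T" for B'
        using cycle_path_disjoint[OF that Q _ h(1)] by auto
    qed (simp_all add: B(1,2) h \<open>e \<in> edges T\<close>)
  qed
qed

lemma IV_edge_off_cycle:
  assumes "v \<in> IV" "C \<in> cycles T"
  obtains e b where "e \<in> edges T" "endpt T e b = v" "e \<notin> C"
  using assms(1)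
proof (cases rule: IV_edges)
  case (1 D E)
  obtain e b where e: "e \<in> D" "endpt T e b = v" using 1(4) by (rule endsE)
  obtain f c where f: "f \<in> E" "endpt T f c = v" using 1(5) by (rule endsE)
  have "e \<in> edges T" "f \<in> edges T" using cycles_subset 1(1,2) e f by auto
  moreover have "e \<notin> C \<or> f \<notin> C" using cycles_eqI assms(2) 1 e f by metis
  ultimately show ?thesis using that e f by blast
next
  case (2 D h)
  then show ?thesis using that assms(2) by blast
qed

section \<open>Values of a direction at a vertex\<close>

lemma opposite_half_edge:
  assumes "direction T \<epsilon>" "fst h \<in> edges T" "endpt T (fst h) (snd h) = v"
  obtains k where "fst k \<in> edges T" "endpt T (fst k) (snd k) = v" "\<epsilon> (fst k) (snd k) \<noteq> \<epsilon> (fst h) (snd h)"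
proof -
  have "v \<in> nodes T" using assms(2,3) edge_endpt by blast
  then have "\<not> sink T (edges T) \<epsilon> v" "\<not> source T (edges T) \<epsilon> v"
    using assms(1) by (auto simp: direction_def)
  then obtain e b f c where "e \<in> edges T" "endpt T e b = v" "\<epsilon> e b \<noteq> 1" "f \<in> edges T" "endpt T f c = v" "\<epsilon> f c \<noteq> -1"
    unfolding sink_def source_def by blast
  moreover have "\<epsilon> (fst h) (snd h) \<in> {1, -1}"
    using assms(1,2) by (auto simp: direction_def orientation_def)
  ultimately show thesis using that[of "(e, b)"] that[of "(f, c)"] by fastforce
qed

text \<open>If \<open>h\<close> and \<open>k\<close> had the same value, some half-edge
  \<open>l\<close> at \<open>v\<close> would have the other one. Away from intersection vertices
  there is no third half-edge. At an intersection vertex the half-edges fall into two classes: a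
  cycle, and either a second cycle or one half-edge of a block path. Values are constant on each
  class, and \<open>h\<close> and \<open>k\<close> lie in different classes, so no class is left for
  \<open>l\<close>.\<close>

lemma coherent:
  assumes dir: "direction T \<epsilon>"
    and h: "fst h \<in> edges T" "endpt T (fst h) (snd h) = v"
    and k: "fst k \<in> edges T" "endpt T (fst k) (snd k) = v"
    and hk: "h \<noteq> k"
    and trans: "\<And>C. v \<in> IV \<Longrightarrow> C \<in> cycles T \<Longrightarrow> fst h \<in> C \<Longrightarrow> fst k \<notin> C"
  shows "\<epsilon> (fst h) (snd h) \<noteq> \<epsilon> (fst k) (snd k)"
proof
  assume eq: "\<epsilon> (fst h) (snd h) = \<epsilon> (fst k) (snd k)"
  obtain l where l: "fst l \<in> edges T" "endpt T (fst l) (snd l) = v" "\<epsilon> (fst l) (snd l) \<noteq> \<epsilon> (fst h) (snd h)"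
    using opposite_half_edge[OF dir h] by metis
  show False
  proof (cases "v \<in> IV")
    case False
    have "v \<in> nodes T" using h edge_endpt by blast
    then obtain p where p: "inj_on (tail (darts T)) (set p)" "inj_on (head (darts T)) (set p)"
      "\<And>e b. e \<in> edges T \<Longrightarrow> endpt T e b = v \<Longrightarrow> e \<in> walk_edges p"
      using non_IV_edges False by metis
    have "h = k \<or> h = l \<or> k = l"
      by (rule three_half_edges[OF p(1,2)]) (use p(3) h k l in blast)
    then show False using hk l(3) eq by auto
  next
    case True
    \<comment> \<open>An intersection vertex is a cut-point, hence a sink or a source of each cycle
      through it.\<close>
    have const: "\<epsilon> (fst i) (snd i) = \<epsilon> (fst j) (snd j)"
      if "C \<in> cycles T" "fst i \<in> C" "fst j \<in> C" "endpt T (fst i) (snd i) = v" "endpt T (fst j) (snd j) = v" for C i j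
    proof -
      have "v \<in> ends T C" using that(2,4) by (rule endsI2)
      then have "sink T C \<epsilon> v \<or> source T C \<epsilon> v"
        using dir that(1) IV_cut_point[OF True] by (auto simp: direction_def)
      then show ?thesis using that unfolding sink_def source_def by metis
    qed
    from True show False
    proof (cases rule: IV_edges)
      case (1 C D)
      have "fst h \<in> C \<union> D" "fst k \<in> C \<union> D" "fst l \<in> C \<union> D" using 1(6) h k l by auto
      with trans[OF True 1(1)] trans[OF True 1(2)] const[OF 1(1)] const[OF 1(2)] h k l eq
      show False by (metis Un_iff)
    next
      case (2 C i)
      have "fst h \<in> C \<or> h = i" "fst k \<in> C \<or> k = i" "fst l \<in> C \<or> l = i" using 2(6) h k l by auto
      with trans[OF True 2(1)] const[OF 2(1)] h k l eq hk
      show False by metis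
    qed
  qed
qed

end

section \<open>Circuits and cut-points\<close>

lemma signed_subgraph_walk:
  assumes H: "signed_subgraph H G" and w: "walk H u p v"
  shows "walk G u p v" "pre_digraph.awalk_verts (darts H) u p = pre_digraph.awalk_verts (darts G) u p"
proof -
  have e: "endpt H e = endpt G e" if "e \<in> walk_edges p" for e
    using H w that by (auto simp: signed_subgraph_def pre_digraph.awalk_def)
  have "pre_digraph.cas (darts H) u p v \<longleftrightarrow> pre_digraph.cas (darts G) u p v"
    using e by (induction p arbitrary: u) (auto simp: pre_digraph.cas.simps)
  then show "walk G u p v"
    using H w by (auto simp: signed_subgraph_def pre_digraph.awalk_def)
  show "pre_digraph.awalk_verts (darts H) u p = pre_digraph.awalk_verts (darts G) u p"
    using e by (induction p arbitrary: u) (auto simp: pre_digraph.awalk_verts.simps)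
qed

lemma signed_subgraph_walkI:
  assumes H: "signed_subgraph H G" and w: "walk G u p v" and "u \<in> nodes H" "walk_edges p \<subseteq> edges H"
  shows "walk H u p v"
proof -
  have e: "endpt H e = endpt G e" if "e \<in> walk_edges p" for e
    using H assms(4) that by (auto simp: signed_subgraph_def)
  have "pre_digraph.cas (darts H) u p v \<longleftrightarrow> pre_digraph.cas (darts G) u p v"
    using e by (induction p arbitrary: u) (auto simp: pre_digraph.cas.simps)
  then show ?thesis
    using assms by (auto simp: pre_digraph.awalk_def)
qed

lemma signed_subgraph_cycles:
  assumes "signed_subgraph H G"
  shows "cycles H \<subseteq> cycles G"
proof
  fix C assume "C \<in> cycles H"
  then obtain p u where p: "C = walk_edges p" "distinct (map fst p)" "p \<noteq> []" "walk H u p u"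
    "distinct (tl (pre_digraph.awalk_verts (darts H) u p))"
    by (auto simp: cycles_def simple_closed_path_def pre_digraph.cycle_def)
  then have "simple_closed_path G p"
    using signed_subgraph_walk[OF assms p(4)] by (auto simp: simple_closed_path_def pre_digraph.cycle_def)
  then show "C \<in> cycles G" using p(1) by (auto simp: cycles_def)
qed

lemma signed_subgraph_ends:
  assumes "signed_subgraph H G" "F \<subseteq> edges H"
  shows "ends H F = ends G F"
proof -
  have "endpt H e = endpt G e" if "e \<in> F" for e
    using assms that by (auto simp: signed_subgraph_def)
  then show ?thesis unfolding ends_def by metis
qed

lemma signed_subgraph_balanced:
  assumes "signed_subgraph H G" "F \<subseteq> edges H"
  shows "balanced H F \<longleftrightarrow> balanced G F"
proof -
  have "(\<Prod>e\<in>F. esign H e) = (\<Prod>e\<in>F. esign G e)"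
    by (rule prod.cong) (use assms in \<open>auto simp: signed_subgraph_def\<close>)
  then show ?thesis by (simp add: balanced_def)
qed

context cycle_tree_graph
begin

lemma cycles_nonempty_cycle_tree: "cycles T \<noteq> {}"
proof -
  obtain v where "v \<in> nodes T" using connected by (auto simp: strongly_connected_def)
  then show ?thesis
  proof (rule nodes_cases)
    fix Q assume "Q \<in> \<P>"
    then obtain C D where "C \<in> cycles T" "D \<in> cycles T" by (rule block_path_end_cycles)
    then show ?thesis by blast
  qed blast
qed

text \<open>There are no isolated vertices, so two cycle-trees of which one is a subgraph of the
  other coincide as soon as their edges do.\<close>

lemma nodes_eq_ends: "nodes T = ends T (edges T)"
proof
  show "nodes T \<subseteq> ends T (edges T)"
  proof
    fix v assume "v \<in> nodes T"
    then show "v \<in> ends T (edges T)"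
    proof (rule nodes_cases)
      fix C assume "C \<in> cycles T" "v \<in> ends T C"
      then show ?thesis by (rule subsetD[OF ends_mono[OF cycles_subset]])
    next
      fix Q assume Q: "Q \<in> \<P>" "v \<in> path_nodes T Q"
      show ?thesis
      proof (cases "snd Q = []")
        case True
        then have "v = path_init Q" using Q(2) by (simp add: path_nodes_conv)
        moreover obtain C D where "C \<noteq> D" "C \<in> cycles T" "D \<in> cycles T" "path_init Q \<in> ends T C" "path_term T Q \<in> ends T D"
          by (rule block_path_end_cycles[OF Q(1)])
        ultimately show ?thesis by (metis subsetD ends_mono cycles_subset)
      next
        case False
        note w = awalkI_apath[OF block_apath[OF Q(1)]]
        have "v \<in> ends T (walk_edges (snd Q))"
          using Q(2) path_nodes_eq_ends[OF w False] by (simp add: path_nodes_conv)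
        then show ?thesis by (rule subsetD[OF ends_mono[OF awalk_edges[OF w]]])
      qed
    qed
  qed
qed (simp add: ends_subset_nodes)

lemma single_cycle:
  assumes "cycles T = {C}"
  shows "\<P> = {}" "edges T = C" "IV = {}"
proof -
  show P: "\<P> = {}"
  proof (rule ccontr)
    assume "\<P> \<noteq> {}"
    then obtain Q where "Q \<in> \<P>" by blast
    then obtain C' D' where "C' \<noteq> D'" "C' \<in> cycles T" "D' \<in> cycles T" by (rule block_path_end_cycles)
    then show False using assms by simp
  qed
  then show "edges T = C" using cycle_tree_unfold(5) assms by simp
  show "IV = {}" using P IV_iff by blast
qed

end

text \<open>
  An edge of a block path is a bridge, so a connected subgraph that contains both cycles contains
  the block paths as well.
\<close>

lemma circuitI:
  assumes E: "eulerian_cycle_tree T \<P>"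
    and small: "(\<exists>C. cycles T = {C}) \<or> (\<exists>C D. cycles T = {C, D} \<and> \<not> balanced T C \<and> \<not> balanced T D)"
  shows "circuit T \<P>"
  unfolding circuit_def
proof (intro conjI notI)
  assume "\<exists>T' \<P>'. proper_signed_subgraph T' T \<and> eulerian_cycle_tree T' \<P>'"
  then obtain T' \<P>' where sub: "signed_subgraph T' T" and ne: "nodes T' \<noteq> nodes T \<or> edges T' \<noteq> edges T"
    and E': "eulerian_cycle_tree T' \<P>'"
    unfolding proper_signed_subgraph_def by blast
  interpret T: cycle_tree_graph T \<P> using E by unfold_locales (simp add: eulerian_cycle_tree_def)
  interpret T': cycle_tree_graph T' \<P>' using E' by unfold_locales (simp add: eulerian_cycle_tree_def)
  have cyc: "cycles T' \<subseteq> cycles T" by (rule signed_subgraph_cycles[OF sub])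
  have edges: "edges T' \<subseteq> edges T" and nodes: "nodes T' \<subseteq> nodes T" using sub by (auto simp: signed_subgraph_def)
  \<comment> \<open>A cycle-tree has some cycle, so fewer cycles than \<open>T\<close> means exactly
    one, and this one is unbalanced in \<open>T\<close>. A single cycle carries no intersection
    vertex, an even number, so it is balanced in \<open>T'\<close>; but the signs agree.\<close>
  have all_cycles: "cycles T' = cycles T"
  proof (rule ccontr)
    assume "cycles T' \<noteq> cycles T"
    obtain C where C: "cycles T' = {C}" "\<not> balanced T C"
      using small
    proof (elim disjE exE conjE)
      fix D assume "cycles T = {D}"
      with cyc T'.cycles_nonempty_cycle_tree \<open>cycles T' \<noteq> cycles T\<close> show thesis
        by (metis subset_singletonD)
    next
      fix D E assume *: "cycles T = {D, E}" "\<not> balanced T D" "\<not> balanced T E"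
      with cyc T'.cycles_nonempty_cycle_tree \<open>cycles T' \<noteq> cycles T\<close> have "cycles T' = {D} \<or> cycles T' = {E}"
        by auto
      with *(2,3) that show thesis by blast
    qed
    have "balanced T' C"
      using E' C(1) T'.single_cycle(3)[OF C(1)] unfolding eulerian_cycle_tree_def by auto
    moreover have "C \<subseteq> edges T'" using T'.cycles_subset C(1) by blast
    ultimately show False using C(2) signed_subgraph_balanced[OF sub] by blast
  qed
  have path_edge: "e \<in> edges T'" if Q: "Q \<in> \<P>" and e: "e \<in> path_edges Q" for Q e
  proof (rule ccontr)
    assume no: "e \<notin> edges T'"
    obtain C D where CD: "C \<noteq> D" "C \<in> cycles T" "D \<in> cycles T" "path_init Q \<in> ends T C" "path_term T Q \<in> ends T D"
      by (rule T.block_path_end_cycles[OF Q])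
    have "B \<subseteq> edges T'" if "B \<in> cycles T" for B using T'.cycles_subset all_cycles that by blast
    then have "path_init Q \<in> nodes T'" "path_term T Q \<in> nodes T'"
      using CD T'.ends_subset_nodes signed_subgraph_ends[OF sub] by (metis subsetD)+
    \<comment> \<open>\<open>T'\<close> is connected and contains the cycles at both ends of
      \<open>Q\<close>, so \<open>r\<close> joins these ends inside \<open>T'\<close> and therefore
      without \<open>e\<close>.\<close>
    then obtain r where r': "walk T' (path_term T Q) r (path_init Q)"
      using T'.connected unfolding strongly_connected_def T'.reachable_awalk by auto
    have r: "walk T (path_term T Q) r (path_init Q)" using signed_subgraph_walk[OF sub r'] by simp
    have er: "e \<notin> walk_edges r" using no T'.awalk_edges[OF r'] by blast
    obtain d where d: "d \<in> set (snd Q)" "fst d = e" using e by (auto simp: T.path_edges_conv walk_edges_def)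
    from d(1) obtain q1 q2 where q: "snd Q = q1 @ d # q2" by (meson split_list)
    have w: "walk T (path_init Q) (q1 @ d # q2) (path_term T Q)"
      using T.block_apath[OF Q] q by (simp add: T.apath_def)
    have q1: "walk T (path_init Q) q1 (endpt T e (snd d))" and q2: "walk T (endpt T e (\<not> snd d)) q2 (path_term T Q)"
      using w d(2) by (auto simp: T.awalk_Cons_iff)
    have "distinct (map fst (q1 @ d # q2))" using T.apath_distinct_edges[OF T.block_apath[OF Q]] q by simp
    then have "e \<notin> walk_edges q1" "e \<notin> walk_edges q2" using d(2) by (auto simp: walk_edges_def)
    then have "e \<notin> walk_edges (q2 @ r @ q1)" using er by simp
    moreover have "walk T (endpt T e (\<not> snd d)) (q2 @ r @ q1) (endpt T e (snd d))"
      by (rule T.awalk_appendI[OF q2 T.awalk_appendI[OF r q1]])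
    moreover have "e \<in> edges T" using e T.awalk_edges[OF w] q by (auto simp: T.path_edges_conv)
    ultimately obtain B where "B \<in> cycles T" "e \<in> B"
      using T.avoiding_walk_cycle by metis
    then show False using T.cycle_path_disjoint Q e by blast
  qed
  have "edges T \<subseteq> edges T'"
  proof
    fix e assume "e \<in> edges T"
    then show "e \<in> edges T'"
      by (rule T.edges_cases) (use path_edge all_cycles T'.cycles_subset in blast)+
  qed
  with edges have "edges T' = edges T" by blast
  moreover have "nodes T = nodes T'"
    unfolding T.nodes_eq_ends T'.nodes_eq_ends using signed_subgraph_ends[OF sub] \<open>edges T' = edges T\<close> by simp
  ultimately show False using ne by simp
qed (rule E)

section \<open>Deletion of a vertex and cut-points\<close>

context finite_sgraph
begin

lemma del_vert_walk:
  assumes "awalk u p w" "v \<notin> set (awalk_verts u p)"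
  shows "pre_digraph.awalk (pre_digraph.del_vert (darts T) v) u p w"
    "pre_digraph.awalk_verts (pre_digraph.del_vert (darts T) v) u p = awalk_verts u p"
proof -
  let ?D = "pre_digraph.del_vert (darts T) v"
  show eq: "pre_digraph.awalk_verts ?D u p = awalk_verts u p"
    by (induction p arbitrary: u) (auto simp: pre_digraph.awalk_verts.simps del_vert_def)
  have "pre_digraph.cas ?D u p w"
  proof -
    have "cas u p w" using assms(1) by auto
    then show ?thesis by (induction p arbitrary: u) (auto simp: pre_digraph.cas.simps del_vert_def)
  qed
  moreover have "u \<noteq> v" using assms hd_in_awalk_verts(1) by blast
  moreover have "tail (darts T) d \<noteq> v \<and> head (darts T) d \<noteq> v" if "d \<in> set p" for d
    using assms that awalk_verts_arc1 awalk_verts_arc2 by metis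
  ultimately show "pre_digraph.awalk ?D u p w"
    using assms(1) unfolding pre_digraph.awalk_def by (auto simp: del_vert_def walk_edges_def)
qed

lemma del_vert_reachable_along:
  assumes "awalk u p w" "v \<notin> set (awalk_verts u p)" "a \<in> set (awalk_verts u p)" "b \<in> set (awalk_verts u p)"
  shows "a \<rightarrow>\<^sup>*\<^bsub>del_vert v\<^esub> b"
proof -
  interpret D: wf_digraph "del_vert v" by (rule wf_digraph_del_vert)
  note w = del_vert_walk[OF assms(1,2)]
  have "u \<rightarrow>\<^sup>*\<^bsub>del_vert v\<^esub> a" "u \<rightarrow>\<^sup>*\<^bsub>del_vert v\<^esub> b"
    using D.awalk_verts_reachable_from[OF w(1)] assms(3,4) w(2) by auto
  then show ?thesis by (rule D.reachable_trans[OF symmetric_reachable[OF symmetric_del_vert_darts]])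
qed

lemma reachable_along:
  assumes "awalk u p w" "a \<in> set (awalk_verts u p)" "b \<in> set (awalk_verts u p)"
  shows "a \<rightarrow>\<^sup>*\<^bsub>darts T\<^esub> b"
  by (rule reachable_trans[OF symmetric_reachable[OF symmetric_darts]])
    (rule awalk_verts_reachable_from[OF assms(1)], fact)+

lemma awalk_last_in_awalk_verts: "awalk u p v \<Longrightarrow> v \<in> set (awalk_verts u p)"
  by (metis awalkE' awalk_verts_non_Nil last_in_set)

text \<open>The vertex \<open>v\<close> occurs only once on the closed walk, so the stretch from
  \<open>x\<close> to \<open>u\<close> or the one from \<open>u\<close> to \<open>x\<close> avoids
  it. The darts are symmetric, so either stretch will do.\<close>

lemma closed_walk_minus_vertex:
  assumes c: "awalk x c x" "distinct (tl (awalk_verts x c))" "c \<noteq> []"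
    and v: "v \<in> set (awalk_verts x c)" "v \<noteq> x"
    and u: "u \<in> set (awalk_verts x c)" "u \<noteq> v"
  shows "x \<rightarrow>\<^sup>*\<^bsub>del_vert v\<^esub> u"
proof -
  have dist: "distinct (map (head (darts T)) c)"
    using c awalk_verts_conv'[of x c x] by auto
  have verts: "set (awalk_verts a p) \<subseteq> insert a (head (darts T) ` set p)" if "awalk a p b" for a p b
    using that awalk_verts_conv'[of a p b] by (cases p) (auto simp: awalk_Cons_iff)
  have lasthead: "b \<in> head (darts T) ` set p" if "awalk a p b" "a \<noteq> b" for a p b
  proof -
    have "b \<in> set (awalk_verts a p)" by (rule awalk_last_in_awalk_verts[OF that(1)])
    then show ?thesis using verts[OF that(1)] that(2) by auto
  qed
  obtain q r where qr: "c = q @ r" "awalk x q v" "awalk v r x"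
    using awalk_decomp[OF c(1) v(1)] by blast
  have "u \<in> set (awalk_verts x q) \<or> u \<in> set (awalk_verts v r)"
    using u(1) set_awalk_verts_append[OF qr(2,3)] qr(1) by auto
  then show ?thesis
  proof
    assume "u \<in> set (awalk_verts x q)"
    then obtain q' s where s: "q = q' @ s" "awalk x q' u" "awalk u s v"
      using awalk_decomp[OF qr(2)] by blast
    have "head (darts T) ` set q' \<inter> head (darts T) ` set s = {}"
      using dist unfolding qr(1) s(1) by auto
    then have "v \<notin> set (awalk_verts x q')"
      using verts[OF s(2)] v(2) lasthead[OF s(3) u(2)] by blast
    then show ?thesis
      by (rule del_vert_reachable_along[OF s(2)]) (use set_awalk_verts[OF s(2)] awalk_last_in_awalk_verts[OF s(2)] in auto)
  next
    assume "u \<in> set (awalk_verts v r)"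
    then obtain s r' where s: "r = s @ r'" "awalk v s u" "awalk u r' x"
      using awalk_decomp[OF qr(3)] by blast
    have "head (darts T) ` set q \<inter> head (darts T) ` set r' = {}"
      using dist unfolding qr(1) s(1) by auto
    then have "v \<notin> set (awalk_verts u r')"
      using verts[OF s(3)] u(2) lasthead[OF qr(2) v(2)[symmetric]] by blast
    then show ?thesis
      by (rule del_vert_reachable_along[OF s(3)]) (use set_awalk_verts[OF s(3)] awalk_last_in_awalk_verts[OF s(3)] in auto)
  qed
qed

lemma card_sccs_connected:
  assumes "fin_digraph D" "z \<in> verts D" "\<And>u. u \<in> verts D \<Longrightarrow> z \<rightarrow>\<^sup>*\<^bsub>D\<^esub> u" "symmetric D"
  shows "card (pre_digraph.sccs_verts D) \<le> 1"
proof -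
  interpret D: fin_digraph D by fact
  have "pre_digraph.scc_of D u = verts D" if "u \<in> verts D" for u
    using assms(3) symmetric_reachable[OF assms(4)] that D.reachable_trans
    unfolding D.scc_of_def by (blast dest: D.reachable_in_verts)
  then have "pre_digraph.sccs_verts D \<subseteq> {verts D}"
    unfolding D.sccs_verts_conv_scc_of by auto
  then show ?thesis using card_mono[of "{verts D}"] by simp
qed

text \<open>\<open>C\<close> hangs on the rest at \<open>x\<close> only. Either \<open>C\<close> has
  another vertex, which is cut off from \<open>y\<close> when \<open>x\<close> is deleted, or there
  is a loop at \<open>x\<close>, which counts as a component besides that of
  \<open>y\<close>.\<close>

lemma cut_pointI:
  assumes conn: "strongly_connected (darts T)"
    and C: "C \<subseteq> edges T" "x \<in> ends T C"
    and cl: "\<And>e b. e \<in> edges T \<Longrightarrow> endpt T e b \<in> ends T C \<Longrightarrow> endpt T e b \<noteq> x \<Longrightarrow> e \<in> C"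
    and y: "y \<in> nodes T" "y \<notin> ends T C"
  shows "cut_point T x"
proof -
  let ?D = "del_vert x"
  let ?L = "{e \<in> edges T. endpt T e False = x \<and> endpt T e True = x}"
  interpret D: fin_digraph ?D by (rule fin_digraph_del_vert)
  have "card (pre_digraph.sccs_verts (darts T)) \<le> 1"
    using card_sccs_connected[OF fin_digraph_axioms _ _ symmetric_darts, of y] conn y(1)
    by (auto simp: strongly_connected_def)
  moreover have yD: "y \<in> verts ?D" using y C(2) by (auto simp: del_vert_def)
  have finL: "finite ?L" using signed_graph by (simp add: signed_graph_def)
  have "2 \<le> card D.sccs_verts + card ?L"
  proof (cases "?L = {}")
    case False
    then have "1 \<le> card ?L" using finL by (simp add: Suc_leI card_gt_0_iff)
    moreover have "1 \<le> card D.sccs_verts"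
      using D.scc_of_in_sccs_verts[OF yD] D.finite_sccs_verts by (metis One_nat_def Suc_leI card_gt_0_iff empty_iff)
    ultimately show ?thesis by simp
  next
    case True
    obtain e b where e: "e \<in> C" "endpt T e b = x" using C(2) by (rule endsE)
    define a where "a = endpt T e (\<not> b)"
    have a: "a \<in> ends T C" "a \<noteq> x" "a \<in> nodes T"
      using True e C(1) edge_endpt unfolding a_def by (cases b; auto intro: endsI)+
    have inv: "pre_digraph.awalk ?D u p w \<Longrightarrow> u \<in> ends T C \<Longrightarrow> w \<in> ends T C" for u p w
    proof (induction p arbitrary: u)
      case (Cons d p)
      then have d: "fst d \<in> edges T" "endpt T (fst d) (snd d) = u" "u \<noteq> x" "D.awalk (endpt T (fst d) (\<not> snd d)) p w"
        by (auto simp: D.awalk_Cons_iff) (auto simp: del_vert_def)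
      have "fst d \<in> C" using cl[OF d(1), of "snd d"] d(2,3) Cons.prems(2) by auto
      then show ?case by (intro Cons.IH[OF d(4)] endsI)
    qed (simp add: D.awalk_Nil_iff)
    have "y \<notin> D.scc_of a"
      using inv[OF _ a(1)] y(2) by (auto simp: D.scc_of_def D.reachable_awalk)
    moreover have "y \<in> D.scc_of y" using yD by (rule D.in_scc_of_self)
    ultimately have "D.scc_of a \<noteq> D.scc_of y" by blast
    moreover have "a \<in> verts ?D" using a by (simp add: del_vert_def)
    then have "{D.scc_of a, D.scc_of y} \<subseteq> D.sccs_verts"
      using D.scc_of_in_sccs_verts yD by blast
    ultimately have "2 \<le> card D.sccs_verts"
      using card_mono[OF D.finite_sccs_verts] by (metis card_2_iff)
    then show ?thesis by simp
  qed
  moreover have "x \<in> nodes T" by (rule subsetD[OF ends_subset_nodes[OF C(1)] C(2)])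
  ultimately show ?thesis unfolding cut_point_def by linarith
qed

lemma not_cut_pointI:
  assumes noloop: "\<And>e. e \<in> edges T \<Longrightarrow> \<not> (endpt T e False = v \<and> endpt T e True = v)"
    and z: "z \<in> nodes T" "z \<noteq> v"
    and reach: "\<And>u. u \<in> nodes T \<Longrightarrow> u \<noteq> v \<Longrightarrow> z \<rightarrow>\<^sup>*\<^bsub>del_vert v\<^esub> u"
  shows "\<not> cut_point T v"
proof
  assume cut: "cut_point T v"
  have L: "{e \<in> edges T. endpt T e False = v \<and> endpt T e True = v} = {}" using noloop by blast
  have "card (pre_digraph.sccs_verts (del_vert v)) \<le> 1"
    by (rule card_sccs_connected[OF fin_digraph_del_vert _ _ symmetric_del_vert_darts])
      (use z reach in \<open>auto simp: del_vert_def\<close>)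
  moreover have "1 \<le> card sccs_verts"
    using scc_of_in_sccs_verts[of z] z finite_sccs_verts by (metis One_nat_def Suc_leI card_gt_0_iff empty_iff darts_simps(1))
  ultimately show False using cut unfolding cut_point_def L by simp
qed

text \<open>Consider the first dart of the path whose edge is in \<open>B\<close>. The part of the
  path from there on contains \<open>B\<close>, which has two half-edges at the initial vertex of
  this part, where a simple path has only one.\<close>

lemma cycle_not_subset_apath:
  assumes "B \<in> cycles T" "apath u p v" "B \<subseteq> walk_edges p"
  shows False
  using assms(2,3)
proof (induction p arbitrary: u)
  case Nil
  then show ?case using cycles_nonempty[OF assms(1)] by simp
next
  case (Cons d p)
  have p: "apath (endpt T (fst d) (\<not> snd d)) p v" "endpt T (fst d) (snd d) = u"
    using Cons.prems(1) by (auto simp: apath_Cons_iff)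
  show ?case
  proof (cases "fst d \<in> B")
    case False
    then show ?thesis using Cons.IH[OF p(1)] Cons.prems(2) by auto
  next
    case True
    then obtain h k where "h \<noteq> k" "fst h \<in> B" "fst k \<in> B" "endpt T (fst h) (snd h) = u" "endpt T (fst k) (snd k) = u"
      using cycle_two_half_edges[OF assms(1) endsI2[OF True p(2)]] by blast
    then show ?thesis using apath_end_half_edge[OF Cons.prems(1), of u h k] Cons.prems(2) by blast
  qed
qed

end

section \<open>Circuits of Type III\<close>

text \<open>The setting of one circuit of Type III inside \<open>T\<close>: unbalanced cycles
  \<open>c\<close> and \<open>d\<close> joined by the path \<open>p\<close>. Edge-disjointness of
  the cycles of \<open>T\<close> is assumed in order to control the cycles of the subgraph
  \<open>H\<close>.\<close>

locale dumbbell = finite_sgraph T for T :: "('v, 'e) sgraph" +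
  fixes x y :: 'v and c p d :: "('e \<times> bool) list"
  assumes c: "walk T x c x" "distinct (tl (pre_digraph.awalk_verts (darts T) x c))" "c \<noteq> []" "distinct (map fst c)"
    and d: "walk T y d y" "distinct (tl (pre_digraph.awalk_verts (darts T) y d))" "d \<noteq> []" "distinct (map fst d)"
    and p: "simple_path T x p y" "p \<noteq> []"
    and cd_disjoint: "ends T (walk_edges c) \<inter> ends T (walk_edges d) = {}"
    and cp_meet: "ends T (walk_edges c) \<inter> ends T (walk_edges p) = {x}"
    and dp_meet: "ends T (walk_edges d) \<inter> ends T (walk_edges p) = {y}"
    and cycles_eqI: "\<And>B B' e. B \<in> cycles T \<Longrightarrow> B' \<in> cycles T \<Longrightarrow> e \<in> B \<Longrightarrow> e \<in> B' \<Longrightarrow> B = B'"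
    and unbalanced: "\<not> balanced T (walk_edges c)" "\<not> balanced T (walk_edges d)"
begin

abbreviation "C \<equiv> walk_edges c"
abbreviation "D \<equiv> walk_edges d"
abbreviation "F \<equiv> C \<union> walk_edges p \<union> D"
definition "H = cpc_graph T C (x, p) D"

lemma H_simps [simp]: "edges H = F" "nodes H = ends T F" "endpt H = endpt T" "esign H = esign T"
  by (simp_all add: H_def cpc_graph_def edge_subgraph_def path_edges_def)

lemma F_subset: "F \<subseteq> edges T"
  using awalk_edges[OF c(1)] awalk_edges[OF d(1)] awalk_edges[OF awalkI_apath[OF p(1)]] by blast

lemma H_subgraph: "signed_subgraph H T"
  using signed_graph F_subset ends_subset_nodes[OF F_subset] finite_subset[OF F_subset]
    finite_subset[OF ends_subset_nodes[OF F_subset]]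
  by (auto simp: signed_subgraph_def signed_graph_def intro: endsI)

lemma ends_H [simp]: "ends H = ends T"
  by (rule ext) (simp add: ends_def)

lemma balanced_H [simp]: "balanced H = balanced T"
  by (rule ext) (simp add: balanced_def)

sublocale H: finite_sgraph H
  using H_subgraph by unfold_locales (simp add: signed_subgraph_def)

lemma H_verts [simp]: "H.awalk_verts u q = awalk_verts u q"
  by (induction q arbitrary: u) (simp_all add: H.awalk_verts.simps)

lemma verts_eq_ends:
  "set (awalk_verts x c) = ends T C" "set (awalk_verts y d) = ends T D" "set (awalk_verts x p) = ends T (walk_edges p)"
  using path_nodes_eq_ends c d p awalkI_apath by blast+

lemma nodes_H: "nodes H = ends T C \<union> ends T (walk_edges p) \<union> ends T D"
  by (simp add: ends_Un)

lemma x_in: "x \<in> ends T C" "x \<in> ends T (walk_edges p)" "x \<notin> ends T D"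
  using cp_meet cd_disjoint by auto

lemma y_in: "y \<in> ends T D" "y \<in> ends T (walk_edges p)" "y \<notin> ends T C"
  using dp_meet cd_disjoint by auto

lemma walks_H: "walk H x c x" "walk H y d y" "walk H x p y" "simple_path H x p y"
proof -
  show "walk H x c x" "walk H y d y" "walk H x p y"
    using c(1) d(1) awalkI_apath[OF p(1)] x_in y_in
    by (auto intro!: signed_subgraph_walkI[OF H_subgraph] simp: ends_Un simp del: awalk_append_iff)
  then show "simple_path H x p y" using p(1) by (simp add: H.apath_def apath_def)
qed

lemma C_cycle: "C \<in> cycles T" "C \<in> cycles H"
proof -
  have "simple_closed_path T c" using c by (rule simple_closed_pathI)
  then show "C \<in> cycles T" by (auto simp: cycles_def)
  have "simple_closed_path H c" using walks_H(1) c by (intro H.simple_closed_pathI) simp_all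
  then show "C \<in> cycles H" by (auto simp: cycles_def)
qed

lemma D_cycle: "D \<in> cycles T" "D \<in> cycles H"
proof -
  have "simple_closed_path T d" using d by (rule simple_closed_pathI)
  then show "D \<in> cycles T" by (auto simp: cycles_def)
  have "simple_closed_path H d" using walks_H(2) d by (intro H.simple_closed_pathI) simp_all
  then show "D \<in> cycles H" by (auto simp: cycles_def)
qed

text \<open>An edge common to a cycle and the path has both ends at their single common vertex, so
  it is a loop; but a loop is a cycle and cannot lie on a simple path.\<close>

lemma edge_disjoint: "C \<inter> D = {}" "C \<inter> walk_edges p = {}" "D \<inter> walk_edges p = {}"
proof -
  show "C \<inter> D = {}" using cd_disjoint endsI[of _ C T True] endsI[of _ D T True] by blast
  have loop: "endpt T e b \<noteq> endpt T e (\<not> b)" if "e \<in> walk_edges p" for e b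
  proof
    assume eq: "endpt T e b = endpt T e (\<not> b)"
    have "e \<in> edges T" using that F_subset by blast
    then have "{e} \<in> cycles T" using eq by (rule loop_cycle)
    then show False using cycle_not_subset_apath[OF _ p(1)] that by blast
  qed
  show "C \<inter> walk_edges p = {}"
  proof (rule equals0I)
    fix e assume "e \<in> C \<inter> walk_edges p"
    then have e: "e \<in> C" "e \<in> walk_edges p" by auto
    have "endpt T e b = x" for b using endsI[OF e(1)] endsI[OF e(2)] cp_meet by blast
    then show False using loop[OF e(2)] by metis
  qed
  show "D \<inter> walk_edges p = {}"
  proof (rule equals0I)
    fix e assume "e \<in> D \<inter> walk_edges p"
    then have e: "e \<in> D" "e \<in> walk_edges p" by auto
    have "endpt T e b = y" for b using endsI[OF e(1)] endsI[OF e(2)] dp_meet by blast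
    then show False using loop[OF e(2)] by metis
  qed
qed

text \<open>A further cycle would be edge-disjoint from \<open>C\<close> and \<open>D\<close>, hence
  contained in the simple path.\<close>

lemma cycles_H: "cycles H = {C, D}"
proof
  show "cycles H \<subseteq> {C, D}"
  proof
    fix B assume B: "B \<in> cycles H"
    then have BT: "B \<in> cycles T" using signed_subgraph_cycles[OF H_subgraph] by blast
    show "B \<in> {C, D}"
    proof (rule ccontr)
      assume "B \<notin> {C, D}"
      then have "B \<inter> C = {}" "B \<inter> D = {}" using cycles_eqI[OF BT] C_cycle D_cycle by blast+
      then have "B \<subseteq> walk_edges p" using H.cycles_subset[OF B] by auto
      then show False by (rule cycle_not_subset_apath[OF BT p(1)])
    qed
  qed
qed (use C_cycle D_cycle in simp)

lemma C_neq_D: "C \<noteq> D"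
  using x_in by auto

lemma H_connected: "strongly_connected (darts H)"
  unfolding strongly_connected_def
proof (intro conjI ballI)
  have x: "x \<rightarrow>\<^sup>*\<^bsub>darts H\<^esub> u" if "u \<in> nodes H" for u
  proof -
    have *: "x \<rightarrow>\<^sup>*\<^bsub>darts H\<^esub> u" if "u \<in> ends T (walk_edges p)" for u
      using H.reachable_along[OF walks_H(3)] that x_in by (simp add: verts_eq_ends)
    show ?thesis
      using that unfolding nodes_H
    proof (elim UnE)
      assume "u \<in> ends T C"
      then show ?thesis using H.reachable_along[OF walks_H(1)] x_in by (simp add: verts_eq_ends)
    next
      assume "u \<in> ends T D"
      then have "y \<rightarrow>\<^sup>*\<^bsub>darts H\<^esub> u" using H.reachable_along[OF walks_H(2)] y_in by (simp add: verts_eq_ends)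
      then show ?thesis using *[OF y_in(2)] by (rule H.reachable_trans[rotated])
    qed (rule *)
  qed
  show "verts (darts H) \<noteq> {}" using x_in by (auto simp: nodes_H simp del: H_simps)
  show "u \<rightarrow>\<^sup>*\<^bsub>darts H\<^esub> v" if "u \<in> verts (darts H)" "v \<in> verts (darts H)" for u v
    using H.reachable_trans[OF symmetric_reachable[OF symmetric_darts x] x] that by (simp del: H_simps)
qed

lemma cut_points_H: "cut_point H x" "cut_point H y"
proof -
  show "cut_point H x"
  proof (rule H.cut_pointI[OF H_connected, of C _ y])
    fix e b assume e: "e \<in> edges H" "endpt H e b \<in> ends H C" "endpt H e b \<noteq> x"
    have "e \<notin> walk_edges p"
      using e(2,3) cp_meet endsI[of e "walk_edges p" T b] by auto
    moreover have "e \<notin> D" using e(2) cd_disjoint endsI[of e D T b] by auto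
    ultimately show "e \<in> C" using e(1) by simp
  qed (use x_in y_in in \<open>auto simp: ends_Un\<close>)
  show "cut_point H y"
  proof (rule H.cut_pointI[OF H_connected, of D _ x])
    fix e b assume e: "e \<in> edges H" "endpt H e b \<in> ends H D" "endpt H e b \<noteq> y"
    have "e \<notin> walk_edges p"
      using e(2,3) dp_meet endsI[of e "walk_edges p" T b] by auto
    moreover have "e \<notin> C" using e(2) cd_disjoint endsI[of e C T b] by auto
    ultimately show "e \<in> D" using e(1) by simp
  qed (use x_in y_in in \<open>auto simp: ends_Un\<close>)
qed

text \<open>A loop is a cycle, so it would be the whole of \<open>C\<close> or \<open>D\<close>,
  with \<open>v\<close> as its only vertex. Loops matter here because \<open>cut_point\<close>
  counts them as components.\<close>

lemma no_loop_H:
  assumes "v \<in> ends T C \<and> v \<noteq> x \<or> v \<in> ends T D \<and> v \<noteq> y" "e \<in> edges H"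
  shows "\<not> (endpt H e False = v \<and> endpt H e True = v)"
proof
  assume e: "endpt H e False = v \<and> endpt H e True = v"
  then have "{e} \<in> cycles H" using H.loop_cycle[OF assms(2), of False] by simp
  then have "C = {e} \<or> D = {e}" using cycles_H by auto
  moreover have "ends T {e} = {v}" using e unfolding ends_def by auto (metis (full_types))
  ultimately have "ends T C = {v} \<or> ends T D = {v}" by auto
  then show False
    using assms(1) x_in(1) y_in(1) cd_disjoint by (metis IntI empty_iff singletonD singletonI)
qed

text \<open>\<open>C\<close> without \<open>v\<close> still hangs together and contains
  \<open>x\<close>, while the path and \<open>D\<close> are untouched. Hence on \<open>C\<close> the
  sink-or-source condition of \<open>direction\<close> concerns \<open>x\<close> alone.\<close>

lemma not_cut_point_C:
  assumes "v \<in> ends T C" "v \<noteq> x"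
  shows "\<not> cut_point H v"
proof (rule H.not_cut_pointI[of v x])
  show "\<not> (endpt H e False = v \<and> endpt H e True = v)" if "e \<in> edges H" for e
    using no_loop_H that assms by blast
  have v: "v \<notin> ends T (walk_edges p)" "v \<notin> ends T D" using assms cp_meet cd_disjoint by auto
  interpret DH: fin_digraph "H.del_vert v" by (rule H.fin_digraph_del_vert)
  have xp: "x \<rightarrow>\<^sup>*\<^bsub>H.del_vert v\<^esub> u" if "u \<in> ends T (walk_edges p)" for u
    using H.del_vert_reachable_along[OF walks_H(3)] that x_in v by (simp add: verts_eq_ends)
  show "x \<rightarrow>\<^sup>*\<^bsub>H.del_vert v\<^esub> u" if u: "u \<in> nodes H" "u \<noteq> v" for u
    using u(1) unfolding nodes_H
  proof (elim UnE)
    assume "u \<in> ends T C"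
    then show ?thesis using H.closed_walk_minus_vertex[OF walks_H(1)] c assms u(2) by (simp add: verts_eq_ends)
  next
    assume "u \<in> ends T D"
    then have "y \<rightarrow>\<^sup>*\<^bsub>H.del_vert v\<^esub> u"
      using H.del_vert_reachable_along[OF walks_H(2)] y_in v by (simp add: verts_eq_ends)
    then show ?thesis using xp[OF y_in(2)] by (rule DH.reachable_trans[rotated])
  qed (rule xp)
qed (use x_in assms in \<open>auto simp: ends_Un\<close>)

lemma not_cut_point_D:
  assumes "v \<in> ends T D" "v \<noteq> y"
  shows "\<not> cut_point H v"
proof (rule H.not_cut_pointI[of v y])
  show "\<not> (endpt H e False = v \<and> endpt H e True = v)" if "e \<in> edges H" for e
    using no_loop_H that assms by blast
  have v: "v \<notin> ends T (walk_edges p)" "v \<notin> ends T C" using assms dp_meet cd_disjoint by auto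
  interpret DH: fin_digraph "H.del_vert v" by (rule H.fin_digraph_del_vert)
  have yp: "y \<rightarrow>\<^sup>*\<^bsub>H.del_vert v\<^esub> u" if "u \<in> ends T (walk_edges p)" for u
    using H.del_vert_reachable_along[OF walks_H(3)] that y_in v by (simp add: verts_eq_ends)
  show "y \<rightarrow>\<^sup>*\<^bsub>H.del_vert v\<^esub> u" if u: "u \<in> nodes H" "u \<noteq> v" for u
    using u(1) unfolding nodes_H
  proof (elim UnE)
    assume "u \<in> ends T D"
    then show ?thesis using H.closed_walk_minus_vertex[OF walks_H(2)] d assms u(2) by (simp add: verts_eq_ends)
  next
    assume "u \<in> ends T C"
    then have "x \<rightarrow>\<^sup>*\<^bsub>H.del_vert v\<^esub> u"
      using H.del_vert_reachable_along[OF walks_H(1)] x_in v by (simp add: verts_eq_ends)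
    then show ?thesis using yp[OF x_in(2)] by (rule DH.reachable_trans[rotated])
  qed (rule yp)
qed (use y_in assms in \<open>auto simp: ends_Un\<close>)

lemma awlast_p: "awlast x p = y"
proof (rule awlast_if_cas)
  show "cas x p y" using awalkI_apath[OF p(1)] by (auto simp: awalk_def)
qed

lemma block_path_H:
  "path_init (x, p) = x" "path_term H (x, p) = y" "path_nodes H (x, p) = ends T (walk_edges p)" "path_edges (x, p) = walk_edges p"
proof -
  show "path_term H (x, p) = y" by (simp add: path_term_def awlast_p)
  show "path_nodes H (x, p) = ends T (walk_edges p)" by (simp add: path_nodes_def verts_eq_ends)
qed (simp_all add: path_init_def path_edges_def)

lemma IV_H: "intersection_vertices H {(x, p)} = {x, y}"
  using cd_disjoint C_neq_D by (auto simp: intersection_vertices_def block_path_H cycles_H)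

lemma cycle_tree_H: "cycle_tree H {(x, p)}"
  unfolding cycle_tree_def
proof (intro conjI)
  show "signed_graph H" by (rule H.signed_graph)
  show "strongly_connected (darts H)" by (rule H_connected)
  show "\<forall>P\<in>{(x, p)}. simple_path H (path_init P) (snd P) (path_term H P)"
    using walks_H by (simp add: block_path_H)
  show "nodes H = (\<Union>C\<in>cycles H. ends H C) \<union> (\<Union>P\<in>{(x, p)}. path_nodes H P)"
    unfolding nodes_H cycles_H by (auto simp: block_path_H)
  show "edges H = (\<Union>C\<in>cycles H. C) \<union> (\<Union>P\<in>{(x, p)}. path_edges P)"
    by (auto simp: block_path_H cycles_H)
  show "\<forall>C\<in>cycles H. \<forall>D\<in>cycles H. C \<noteq> D \<longrightarrow> C \<inter> D = {}"
    using edge_disjoint by (auto simp: cycles_H)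
  show "\<forall>C\<in>cycles H. \<forall>P\<in>{(x, p)}. C \<inter> path_edges P = {}"
    using edge_disjoint by (auto simp: cycles_H block_path_H)
  show "\<forall>C\<in>cycles H. \<forall>D\<in>cycles H. C \<noteq> D \<longrightarrow> card (ends H C \<inter> ends H D) \<le> 1"
    using cd_disjoint by (simp add: cycles_H Int_commute)
  show "\<forall>C\<in>cycles H. \<forall>D\<in>cycles H. C \<noteq> D \<longrightarrow> (\<forall>v\<in>ends H C \<inter> ends H D. (v, []) \<in> {(x, p)})"
    using cd_disjoint by (auto simp: cycles_H)
  have "{B \<in> cycles H. ends H B \<inter> path_nodes H (x, p) \<noteq> {}} = {C, D}"
    using cp_meet dp_meet by (auto simp: cycles_H block_path_H)
  then show "\<forall>P\<in>{(x, p)}. \<exists>C D. C \<noteq> D \<and> {B \<in> cycles H. ends H B \<inter> path_nodes H P \<noteq> {}} = {C, D} \<and>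
      ends H C \<inter> path_nodes H P = {path_init P} \<and> ends H D \<inter> path_nodes H P = {path_term H P}"
    using C_neq_D cp_meet dp_meet by (simp add: block_path_H) blast
  show "\<forall>v\<in>intersection_vertices H {(x, p)}. cut_point H v"
    using cut_points_H by (simp add: IV_H)
qed simp

text \<open>Each cycle carries one intersection vertex, an odd number as required of an unbalanced
  cycle; minimality is \<open>circuitI\<close>.\<close>

lemma circuit_H: "circuit H {(x, p)}"
proof (rule circuitI)
  have "ends T C \<inter> {x, y} = {x}" "ends T D \<inter> {x, y} = {y}" using x_in y_in by auto
  then show "eulerian_cycle_tree H {(x, p)}"
    unfolding eulerian_cycle_tree_def using cycle_tree_H unbalanced by (simp add: cycles_H IV_H)
qed (use cycles_H unbalanced in auto)

lemma type_III: "type_III_circuit T C (x, p) D"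
proof -
  have "path_term T (x, p) = y" "path_nodes T (x, p) = ends T (walk_edges p)"
    by (simp_all add: path_term_def path_nodes_def verts_eq_ends awlast_p)
  then show ?thesis
    unfolding type_III_circuit_def
    using circuit_H C_cycle D_cycle unbalanced cd_disjoint p cp_meet dp_meet
    by (simp add: H_def path_init_def)
qed

text \<open>Two half-edges of \<open>F\<close> with different values exclude sinks and sources. The
  only cut-points on the two cycles are \<open>x\<close> and \<open>y\<close>, which the last two
  assumptions treat.\<close>

lemma direction_H:
  assumes "orientation T \<epsilon>"
    and "\<And>v. v \<in> ends T F \<Longrightarrow> \<exists>h k. fst h \<in> F \<and> fst k \<in> F \<and> endpt T (fst h) (snd h) = v \<and>
      endpt T (fst k) (snd k) = v \<and> \<epsilon> (fst h) (snd h) \<noteq> \<epsilon> (fst k) (snd k)"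
    and "sink T C \<epsilon> x \<or> source T C \<epsilon> x" "sink T D \<epsilon> y \<or> source T D \<epsilon> y"
  shows "direction H \<epsilon>"
  unfolding direction_def
proof (intro conjI ballI impI)
  show "orientation H \<epsilon>" using assms(1) F_subset unfolding orientation_def by auto
  fix v assume "v \<in> nodes H"
  then obtain h k where *: "fst h \<in> F" "fst k \<in> F" "endpt T (fst h) (snd h) = v"
      "endpt T (fst k) (snd k) = v" "\<epsilon> (fst h) (snd h) \<noteq> \<epsilon> (fst k) (snd k)"
    using assms(2) by (metis H_simps(2))
  show "\<not> sink H (edges H) \<epsilon> v"
  proof
    assume "sink H (edges H) \<epsilon> v"
    then have "\<epsilon> e b = -1" if "e \<in> F" "endpt T e b = v" for e b using that by (simp only: sink_def H_simps)
    then show False using * by metis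
  qed
  show "\<not> source H (edges H) \<epsilon> v"
  proof
    assume "source H (edges H) \<epsilon> v"
    then have "\<epsilon> e b = 1" if "e \<in> F" "endpt T e b = v" for e b using that by (simp only: source_def H_simps)
    then show False using * by metis
  qed
next
  fix B v assume B: "B \<in> cycles H" "v \<in> ends H B" "cut_point H v"
  have eq: "sink H = sink T" "source H = source T" by (intro ext; simp add: sink_def source_def)+
  from B(1) have "B = C \<or> B = D" by (simp add: cycles_H)
  then show "sink H B \<epsilon> v \<or> source H B \<epsilon> v"
  proof
    assume "B = C"
    then have "v = x" using not_cut_point_C B(2,3) by auto
    then show ?thesis using assms(3) \<open>B = C\<close> eq by simp
  next
    assume "B = D"
    then have "v = y" using not_cut_point_D B(2,3) by auto
    then show ?thesis using assms(4) \<open>B = D\<close> eq by simp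
  qed
qed

text \<open>By edge-disjointness the nested case distinction becomes a sum, which can be added up
  over all circuits.\<close>

lemma edge_indicator_H:
  "edge_indicator H {(x, p)} e = of_bool (e \<in> C) + of_bool (e \<in> D) + 2 * of_bool (e \<in> walk_edges p)"
  using edge_disjoint by (auto simp: edge_indicator_def cycles_H block_path_H)

end

section \<open>Tours of cycle-trees\<close>

lemma count_list_distinct: "distinct xs \<Longrightarrow> count_list xs a = of_bool (a \<in> set xs)"
  by (induction xs) auto

lemma count_list_concat_upt:
  "count_list (map h (concat (map f [0..<n]))) a = (\<Sum>i<n. count_list (map h (f i)) a)"
  by (induction n) auto

lemma not_distinct_map_split:
  assumes "\<not> distinct (map f S)"
  shows "\<exists>X a Y b Z. S = X @ a # Y @ b # Z \<and> f a = f b"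
  using assms
proof (induction S)
  case (Cons s S)
  show ?case
  proof (cases "f s \<in> f ` set S")
    case True
    then obtain b where b: "b \<in> set S" "f s = f b" by blast
    from b(1) obtain Y Z where "S = Y @ b # Z" by (meson split_list)
    with b(2) show ?thesis by (intro exI[of _ "[]"]) auto
  next
    case False
    with Cons obtain X a Y b Z where "S = X @ a # Y @ b # Z" "f a = f b" by auto
    then show ?thesis by (intro exI[of _ "s # X"]) auto
  qed
qed simp

locale noncircuit_cycle_tree = cycle_tree_graph T \<P>
  for T :: "('v, 'e) sgraph" and \<P> :: "('v, 'e) bpath set" +
  fixes \<epsilon> :: "'e \<Rightarrow> bool \<Rightarrow> int"
  assumes eulerian: "eulerian_cycle_tree T \<P>"
    and direction: "direction T \<epsilon>"
    and not_circuit: "\<not> circuit T \<P>"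
begin

text \<open>The base point is existential so that the notion is invariant under rotation; any two
  consecutive darts can then be moved to the front of the list.\<close>

definition is_tour :: "('e \<times> bool) list \<Rightarrow> bool" where
  "is_tour W \<longleftrightarrow> (\<exists>u. walk T u W u) \<and>
     (\<forall>C\<in>cycles T. \<forall>e\<in>C. count_list (map fst W) e = 1) \<and>
     (\<forall>Q\<in>\<P>. \<forall>e\<in>path_edges Q. count_list (map fst W) e = 2)"

lemma tour_rotate:
  assumes "is_tour (A @ B)"
  shows "is_tour (B @ A)"
proof -
  obtain u where u: "awalk u (A @ B) u" using assms by (auto simp: is_tour_def simp del: awalk_append_iff)
  then have "awalk u A (awlast u A)" "awalk (awlast u A) B u" by simp_all
  then have "awalk (awlast u A) (B @ A) (awlast u A)" using awalk_appendI by blast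
  then show ?thesis using assms unfolding is_tour_def by (auto simp: add.commute simp del: awalk_append_iff)
qed

lemma tour_count_cycle: "is_tour W \<Longrightarrow> C \<in> cycles T \<Longrightarrow> e \<in> C \<Longrightarrow> count_list (map fst W) e = 1"
  by (simp add: is_tour_def)

lemma tour_count_path: "is_tour W \<Longrightarrow> Q \<in> \<P> \<Longrightarrow> e \<in> path_edges Q \<Longrightarrow> count_list (map fst W) e = 2"
  by (simp add: is_tour_def)

lemma tour_edges:
  assumes "is_tour W"
  shows "walk_edges W = edges T"
proof
  show "walk_edges W \<subseteq> edges T" using assms awalk_edges by (auto simp: is_tour_def)
  show "edges T \<subseteq> walk_edges W"
  proof
    fix e assume "e \<in> edges T"
    then have "count_list (map fst W) e \<noteq> 0"
      by (rule edges_cases) (use tour_count_cycle[OF assms] tour_count_path[OF assms] in auto)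
    then show "e \<in> walk_edges W" unfolding walk_edges_def by (metis count_notin list.set_map)
  qed
qed

lemma tour_walk_ConsE:
  assumes "is_tour (d # d' # R)"
  shows "fst d \<in> edges T" "fst d' \<in> edges T" "head (darts T) d = tail (darts T) d'"
    "awalk (head (darts T) d') R (tail (darts T) d)"
  using assms by (auto simp: is_tour_def awalk_Cons_iff)

text \<open>The tour uses every edge, so it uses \<open>g\<close> within \<open>R\<close>, and
  \<open>R\<close> can be cut where it passes through \<open>v\<close>.\<close>

lemma edge_in_rest:
  assumes t: "is_tour (d # d' # R)" and g: "g \<in> edges T" "g \<noteq> fst d" "g \<noteq> fst d'" "endpt T g b = v"
  obtains R1 R2 where "R = R1 @ R2" "awalk (head (darts T) d') R1 v" "awalk v R2 (tail (darts T) d)"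
proof -
  have "g \<in> walk_edges R" using tour_edges[OF t] g by auto
  moreover from this have "R \<noteq> []" by auto
  ultimately have "v \<in> set (awalk_verts (head (darts T) d') R)"
    using path_nodes_eq_ends[OF tour_walk_ConsE(4)[OF t]] endsI2[OF _ g(4)] by simp
  then show thesis using that awalk_decomp[OF tour_walk_ConsE(4)[OF t]] by blast
qed

text \<open>
  Only an edge \<open>e\<close> of a block path can be traversed forth and back in succession; then the rest of
  the tour joins the ends of \<open>e\<close> without using \<open>e\<close>, so \<open>e\<close> lies on a cycle.
\<close>

lemma no_backtrack:
  assumes t: "is_tour (d # d' # R)"
  shows "d' \<noteq> dart_rev d"
proof
  assume rev: "d' = dart_rev d"
  note w = tour_walk_ConsE[OF t]
  let ?e = "fst d" and ?v = "endpt T (fst d) (\<not> snd d)"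
  have c2: "count_list (map fst (d # d' # R)) ?e = 2 + count_list (map fst R) ?e" using rev by simp
  have nocyc: "?e \<notin> C" if "C \<in> cycles T" for C
    using tour_count_cycle[OF t that] c2 by force
  with w(1) obtain Q where Q: "Q \<in> \<P>" "?e \<in> path_edges Q"
    using edges_cases by metis
  have "count_list (map fst R) ?e = 0" using tour_count_path[OF t Q] c2 by simp
  then have eR: "?e \<notin> walk_edges R" by (simp add: count_list_0_iff walk_edges_def)
  \<comment> \<open>The turning vertex is neither a sink nor a source, so it has a second half-edge:
    either another edge is present or \<open>?e\<close> is a loop.\<close>
  obtain k where k: "fst k \<in> edges T" "endpt T (fst k) (snd k) = ?v" "\<epsilon> (fst k) (snd k) \<noteq> \<epsilon> ?e (\<not> snd d)"
    using opposite_half_edge[OF direction, of "dart_rev d"] w(1) by auto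
  show False
  proof (cases "fst k = ?e")
    case True
    have "snd k \<noteq> (\<not> snd d)"
    proof
      assume "snd k = (\<not> snd d)"
      with True k(3) show False by simp
    qed
    then have "snd k = snd d" by simp
    then have "endpt T ?e (snd d) = endpt T ?e (\<not> snd d)" using k(2) True by simp
    then have "{?e} \<in> cycles T" by (rule loop_cycle[OF w(1)])
    then show False using nocyc by blast
  next
    case False
    then have "fst k \<noteq> fst d'" using rev by simp
    then obtain R1 R2 where R: "R = R1 @ R2" "awalk ?v R2 (tail (darts T) d)"
      by (rule edge_in_rest[OF t k(1) False _ k(2)])
    have "awalk ?v R2 (endpt T ?e (snd d))" using R(2) by simp
    moreover have "?e \<notin> walk_edges R2" using eR R(1) by simp
    ultimately obtain B where "B \<in> cycles T" "?e \<in> B" using avoiding_walk_cycle[OF _ w(1)] by metis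
    then show False using nocyc by blast
  qed
qed

text \<open>
  The rest \<open>R\<close> of the tour returns to the intersection vertex to pick up an edge outside of \<open>C\<close>.
  Up to that point it closes up with \<open>fst d'\<close> to a cycle that shares \<open>fst d'\<close> but not \<open>fst d\<close>
  with \<open>C\<close>.
\<close>

lemma no_stay_on_cycle:
  assumes t: "is_tour (d # d' # R)" and v: "head (darts T) d \<in> IV"
    and C: "C \<in> cycles T" "fst d \<in> C"
  shows "fst d' \<notin> C"
proof
  assume d': "fst d' \<in> C"
  note w = tour_walk_ConsE[OF t]
  have ne: "fst d \<noteq> fst d'" using tour_count_cycle[OF t C] by auto
  have "count_list (map fst R) (fst d) = 0" "count_list (map fst R) (fst d') = 0"
    using tour_count_cycle[OF t C] tour_count_cycle[OF t C(1) d'] ne by auto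
  then have nR: "fst d \<notin> walk_edges R" "fst d' \<notin> walk_edges R" by (simp_all add: count_list_0_iff walk_edges_def)
  obtain g b where g: "g \<in> edges T" "endpt T g b = head (darts T) d" "g \<notin> C"
    using IV_edge_off_cycle[OF v C(1)] by metis
  then have "g \<noteq> fst d" "g \<noteq> fst d'" using C d' by auto
  then obtain R1 R2 where R: "R = R1 @ R2" "awalk (head (darts T) d') R1 (head (darts T) d)"
    using edge_in_rest[OF t g(1) _ _ g(2)] by metis
  then obtain B where B: "B \<in> cycles T" "fst d' \<in> B" "B \<subseteq> insert (fst d') (walk_edges R1)"
    using avoiding_walk_cycle[of "fst d'" "snd d'" R1] w(2,3) nR by auto
  then have "B = C" using cycles_eqI C(1) d' by blast
  then show False using B(3) C(2) ne nR R(1) by auto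
qed

text \<open>The tour enters the vertex through \<open>dart_rev d\<close> and leaves it through
  \<open>d'\<close>. That it neither turns back nor stays on a cycle at an intersection vertex is
  exactly what \<open>coherent\<close> asks for.\<close>

lemma tour_coherent:
  assumes t: "is_tour (d # d' # R)"
  shows "\<epsilon> (fst d) (\<not> snd d) \<noteq> \<epsilon> (fst d') (snd d')"
proof -
  note w = tour_walk_ConsE[OF t]
  have "\<epsilon> (fst (dart_rev d)) (snd (dart_rev d)) \<noteq> \<epsilon> (fst d') (snd d')"
  proof (rule coherent[OF direction, of _ "head (darts T) d"])
    show "fst d' \<notin> C" if "head (darts T) d \<in> IV" "C \<in> cycles T" "fst (dart_rev d) \<in> C" for C
      using no_stay_on_cycle[OF t that(1,2)] that(3) by simp
    show "dart_rev d \<noteq> d'" using no_backtrack[OF t] by blast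
  qed (use w in simp_all)
  then show ?thesis by simp
qed

lemma tour_consecutive: "is_tour (A @ L1 @ [d, d'] @ L2 @ B) \<Longrightarrow> is_tour (d # d' # L2 @ B @ A @ L1)"
  using tour_rotate[of "A @ L1" "[d, d'] @ L2 @ B"] by simp

text \<open>One is odd, so the Eulerian condition excludes a balanced cycle.\<close>

lemma end_block_cyclesD:
  assumes "D \<in> end_block_cycles T \<P>"
  shows "D \<in> cycles T" "\<exists>v. ends T D \<inter> IV = {v}" "\<not> balanced T D"
proof -
  show D: "D \<in> cycles T" using assms by (simp add: end_block_cycles_def)
  have 1: "card (ends T D \<inter> IV) = 1" using assms by (simp add: end_block_cycles_def)
  then show "\<exists>v. ends T D \<inter> IV = {v}" by (meson card_1_singletonE)
  show "\<not> balanced T D" using eulerian D 1 unfolding eulerian_cycle_tree_def by (metis odd_one)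
qed

text \<open>Otherwise no edge leaves \<open>C\<close>, so \<open>C\<close> is all of
  \<open>T\<close> by connectedness; but a cycle-tree with a single cycle is a circuit.\<close>

lemma cycle_meets_IV:
  assumes "C \<in> cycles T"
  shows "ends T C \<inter> IV \<noteq> {}"
proof
  assume e: "ends T C \<inter> IV = {}"
  have "C = edges T"
    by (rule closed_component[OF connected cycles_subset[OF assms] cycles_nonempty[OF assms]])
      (use cycle_leaves_at_IV[OF assms] e in blast)
  then have "B = C" if "B \<in> cycles T" for B
    using cycles_eqI[OF that assms] cycles_subset[OF that] cycles_nonempty[OF that] by blast
  then have "cycles T = {C}" using assms by blast
  then show False using circuitI[OF eulerian] not_circuit by blast
qed

text \<open>A common vertex \<open>u\<close> is the only intersection vertex of both cycles, and
  there is no room for further edges at \<open>u\<close>. So nothing leaves the union of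
  \<open>D\<close> and \<open>E\<close>, and \<open>T\<close> consists of two unbalanced cycles
  touching at \<open>u\<close>, which is a circuit.\<close>

lemma end_block_cycles_disjoint:
  assumes D: "D \<in> end_block_cycles T \<P>" and E: "E \<in> end_block_cycles T \<P>" and "D \<noteq> E"
  shows "ends T D \<inter> ends T E = {}"
proof (rule equals0I)
  fix u assume "u \<in> ends T D \<inter> ends T E"
  then have u: "u \<in> ends T D" "u \<in> ends T E" by auto
  note Dc = end_block_cyclesD(1)[OF D] and Ec = end_block_cyclesD(1)[OF E]
  have uIV: "u \<in> IV" unfolding IV_iff
    using shared_vertex[OF Dc Ec assms(3) u] by (intro bexI[of _ "(u, [])"]) (simp_all add: path_init_def)
  have only_D: "v = u" if "v \<in> ends T D" "v \<in> IV" for v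
    using end_block_cyclesD(2)[OF D] u(1) uIV that by (metis IntI singletonD)
  have only_E: "v = u" if "v \<in> ends T E" "v \<in> IV" for v
    using end_block_cyclesD(2)[OF E] u(2) uIV that by (metis IntI singletonD)
  obtain e b0 where e: "e \<in> D" "endpt T e b0 = u" using u(1) by (rule endsE)
  obtain f c0 where f: "f \<in> E" "endpt T f c0 = u" using u(2) by (rule endsE)
  have ef: "e \<in> edges T" "f \<in> edges T" using e f cycles_subset Dc Ec by auto
  have at_u: "g \<in> D \<union> E" if g: "g \<in> edges T" "endpt T g b = u" for g b
    using uIV
  proof (cases rule: IV_edges)
    case (1 B B')
    have "e \<in> B \<union> B'" "f \<in> B \<union> B'" "g \<in> B \<union> B'" using 1(6) ef e f g by blast+
    then have "D \<in> {B, B'}" "E \<in> {B, B'}"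
      using cycles_eqI[OF 1(1) Dc _ e(1)] cycles_eqI[OF 1(2) Dc _ e(1)]
        cycles_eqI[OF 1(1) Ec _ f(1)] cycles_eqI[OF 1(2) Ec _ f(1)] by auto
    then show ?thesis using \<open>D \<noteq> E\<close> \<open>g \<in> B \<union> B'\<close> by blast
  next
    \<comment> \<open>A block path of positive length at \<open>u\<close> would leave room for one
      cycle only.\<close>
    case (2 B h)
    have "B = D" using 2(6)[of "(e, b0)"] 2(5)[OF Dc] ef e cycles_eqI[OF 2(1) Dc _ e(1)] by fastforce
    moreover have "B = E" using 2(6)[of "(f, c0)"] 2(5)[OF Ec] ef f cycles_eqI[OF 2(1) Ec _ f(1)] by fastforce
    ultimately show ?thesis using \<open>D \<noteq> E\<close> by simp
  qed
  have "D \<union> E = edges T"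
  proof (rule closed_component[OF connected])
    fix g b assume g: "g \<in> edges T" "endpt T g b \<in> ends T (D \<union> E)"
    show "g \<in> D \<union> E"
    proof (rule ccontr)
      assume n: "g \<notin> D \<union> E"
      from g(2) consider "endpt T g b \<in> ends T D" | "endpt T g b \<in> ends T E" by (auto simp: ends_Un)
      then have "endpt T g b = u"
      proof cases
        case 1
        then show ?thesis using only_D[OF 1] cycle_leaves_at_IV[OF Dc 1 g(1) refl] n by simp
      next
        case 2
        then show ?thesis using only_E[OF 2] cycle_leaves_at_IV[OF Ec 2 g(1) refl] n by simp
      qed
      then show False using at_u g(1) n by blast
    qed
  qed (use cycles_subset[OF Dc] cycles_subset[OF Ec] e in auto)
  then have "B = D \<or> B = E" if "B \<in> cycles T" for B
    using cycles_eqI[OF that Dc] cycles_eqI[OF that Ec] cycles_subset[OF that] cycles_nonempty[OF that] by blast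
  then have "cycles T = {D, E}" using Dc Ec by blast
  then show False
    using circuitI[OF eulerian] not_circuit end_block_cyclesD(3)[OF D] end_block_cyclesD(3)[OF E] by blast
qed

section \<open>Cutting the tour at its minimal closed subwalks\<close>

definition traversal :: "'v \<Rightarrow> ('e \<times> bool) list \<Rightarrow> bool" where
  "traversal v S \<longleftrightarrow> awalk v S v \<and> S \<noteq> [] \<and> distinct (tl (awalk_verts v S)) \<and> distinct (map fst S) \<and>
     walk_edges S \<in> end_block_cycles T \<P> \<and> ends T (walk_edges S) \<inter> IV = {v}"

lemma closed_subwalk_traversal:
  assumes t: "is_tour (A @ S @ B)" and S: "awalk v S v" "S \<noteq> []" "distinct (tl (awalk_verts v S))"
  shows "traversal v S"
proof -
  have dS: "distinct S" by (rule distinct_tl_verts_imp_distinct[OF S(1,3)])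
  have "distinct (map fst S)"
  proof (rule ccontr)
    assume "\<not> distinct (map fst S)"
    then obtain X d1 Y d2 Z where Sd: "S = X @ d1 # Y @ d2 # Z" "fst d1 = fst d2"
      using not_distinct_map_split by blast
    then have "d1 \<noteq> d2" using dS by auto
    then have d2: "d2 = dart_rev d1" using Sd by (auto simp: dart_rev_def prod_eq_iff)
    show False
    proof (cases Y)
      case Nil
      then show False using no_backtrack[OF tour_consecutive[of A X d1 d2 Z B]] t Sd(1) d2 by simp
    next
      \<comment> \<open>The dart \<open>y\<close> after \<open>d1\<close> starts where
        \<open>d1\<close> ends, which is also where \<open>d2\<close> starts. Tails are distinct on
        \<open>S\<close>, so \<open>y\<close> would be \<open>d2\<close> itself.\<close>
      case (Cons y Y')
      have "head (darts T) d1 = tail (darts T) y"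
        using S(1) unfolding Sd(1) Cons by (auto simp: awalk_Cons_iff)
      then have "tail (darts T) y = tail (darts T) d2" using d2 by simp
      then have "y = d2"
        using inj_onD[OF closed_walk_inj(1)[OF S(1,3,2)], of y d2] Sd(1) Cons by simp
      then show False using dS Sd(1) Cons by simp
    qed
  qed
  then have "simple_closed_path T S" using S by (intro simple_closed_pathI)
  then have C: "walk_edges S \<in> cycles T" by (auto simp: cycles_def)
  \<comment> \<open>At a vertex other than the base point \<open>S\<close> arrives and leaves along
    the same cycle, which \<open>no_stay_on_cycle\<close> forbids at an intersection vertex.\<close>
  have "u = v" if u: "u \<in> ends T (walk_edges S)" "u \<in> IV" for u
  proof (rule ccontr)
    assume "u \<noteq> v"
    have "u \<in> set (awalk_verts v S)" using u(1) path_nodes_eq_ends[OF S(1,2)] by simp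
    then obtain S1 S2 where S12: "S = S1 @ S2" "awalk v S1 u" "awalk u S2 v"
      using awalk_decomp[OF S(1)] by blast
    then have "S1 \<noteq> []" "S2 \<noteq> []" using \<open>u \<noteq> v\<close> by (auto simp: awalk_Nil_iff)
    then obtain S1' d d' S2' where S12': "S1 = S1' @ [d]" "S2 = d' # S2'" by (meson rev_exhaust list.exhaust)
    have "is_tour (d # d' # S2' @ B @ A @ S1')"
      by (rule tour_consecutive) (use t S12(1) S12' in simp)
    moreover have "head (darts T) d = u" using S12(2) S12'(1) by (simp add: awalk_simps)
    ultimately show False using no_stay_on_cycle[OF _ _ C, of d d'] u(2) S12(1) S12' by auto
  qed
  then have IV: "ends T (walk_edges S) \<inter> IV = {v}" using cycle_meets_IV[OF C] by blast
  then show ?thesis using C S \<open>distinct (map fst S)\<close> by (simp add: traversal_def end_block_cycles_def)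
qed

text \<open>\<open>C0\<close> stands for the piece just before \<open>R\<close>. In the induction
  step the closed subwalk \<open>S\<close> cut out of \<open>R\<close> takes this role, so nothing
  is claimed about \<open>C0\<close> itself. \<open>A\<close> and \<open>B\<close> keep the context
  that makes the whole list a tour.\<close>

lemma tour_decomposition_aux:
  assumes "is_tour (A @ R @ B)" "awalk x R y"
  shows "\<exists>k xs C P. C 0 = C0 \<and> xs 0 = x \<and> xs (k + 1) = y \<and>
    C0 @ R = concat (map (\<lambda>i. C i @ P (i + 1)) [0..<k + 1]) \<and>
    (\<forall>i\<le>k. apath (xs i) (P (i + 1)) (xs (i + 1))) \<and>
    (\<forall>i. 1 \<le> i \<and> i \<le> k \<longrightarrow> traversal (xs i) (C i))"
  using assms
proof (induction "length R" arbitrary: A R x C0 rule: less_induct)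
  case less
  show ?case
  proof (cases "apath x R y")
    case True
    then show ?thesis
      by (intro exI[of _ 0] exI[of _ "\<lambda>i. if i = 0 then x else y"] exI[of _ "\<lambda>_. C0"] exI[of _ "\<lambda>_. R"]) simp
  next
    case False
    then obtain P1 S R' v where R: "R = P1 @ S @ R'" "apath x P1 v" "awalk v S v" "S \<noteq> []"
      "distinct (tl (awalk_verts v S))" "awalk v R' y"
      using first_closed_subwalk[OF less.prems(2)] by blast
    have S: "traversal v S"
      by (rule closed_subwalk_traversal[of "A @ P1" S "R' @ B"]) (use less.prems(1) R in simp_all)
    have len: "length R' < length R" using R(1,4) by simp
    have tour: "is_tour ((A @ P1 @ S) @ R' @ B)" using less.prems(1) R(1) by simp
    obtain k xs C P where IH: "C 0 = S" "xs 0 = v" "xs (k + 1) = y"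
      "S @ R' = concat (map (\<lambda>i. C i @ P (i + 1)) [0..<k + 1])"
      "\<forall>i\<le>k. apath (xs i) (P (i + 1)) (xs (i + 1))"
      "\<forall>i. 1 \<le> i \<and> i \<le> k \<longrightarrow> traversal (xs i) (C i)"
      using less.hyps[OF len tour R(6), of S] by (elim exE conjE) (rule that)
    \<comment> \<open>The new piece gets index 0 and all others move up by one. Paths are numbered
      from 1, so \<open>P' 0\<close> is a dummy value.\<close>
    define C' where "C' = case_nat C0 C"
    define xs' where "xs' = case_nat x xs"
    define P' where "P' = case_nat [] (case_nat P1 (\<lambda>i. P (i + 1)))"
    have shift: "[0..<Suc k + 1] = 0 # map Suc [0..<k + 1]"
      using upt_conv_Cons[of 0 "Suc k + 1"] map_Suc_upt[of 0 "k + 1"] by (simp del: upt_Suc)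
    have "concat (map (\<lambda>i. C' i @ P' (i + 1)) [0..<Suc k + 1]) =
        C0 @ P1 @ concat (map (\<lambda>i. C i @ P (i + 1)) [0..<k + 1])"
      unfolding shift by (simp add: C'_def P'_def o_def del: upt_Suc)
    then have "C0 @ R = concat (map (\<lambda>i. C' i @ P' (i + 1)) [0..<Suc k + 1])"
      using IH(4) R(1) by simp
    moreover have "apath (xs' i) (P' (i + 1)) (xs' (i + 1))" if "i \<le> Suc k" for i
      using that IH(2,5) R(2) by (cases i) (auto simp: xs'_def P'_def)
    moreover have "traversal (xs' i) (C' i)" if i: "1 \<le> i" "i \<le> Suc k" for i
    proof -
      obtain j where j: "i = Suc j" using i(1) by (cases i) auto
      show ?thesis using i IH(1,2,6) S by (cases "j = 0") (auto simp: j xs'_def C'_def)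
    qed
    ultimately show ?thesis
      using IH(3) by (intro exI[of _ "Suc k"] exI[of _ xs'] exI[of _ C'] exI[of _ P']) (auto simp: C'_def xs'_def)
  qed
qed

lemma traversal_IV: "traversal v S \<Longrightarrow> v \<in> IV"
  by (auto simp: traversal_def)

text \<open>A nonempty closed walk is not a simple path, so it contains a minimal closed subwalk
  \<open>S\<close>. Rotating the tour to begin with \<open>S\<close> leaves a closed walk
  \<open>R\<close> at the same vertex, to which \<open>tour_decomposition_aux\<close> applies with
  \<open>S\<close> for \<open>C0\<close>.\<close>

lemma tour_decomposition:
  assumes t: "is_tour W"
  obtains k C xs m P where "k \<ge> 1" "C (k + 1) = C 0" "xs (k + 1) = xs 0"
    "rotate m W = concat (map (\<lambda>i. C i @ P (i + 1)) [0..<k + 1])"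
    "\<And>i. i \<le> k + 1 \<Longrightarrow> traversal (xs i) (C i)"
    "\<And>i. i \<le> k \<Longrightarrow> apath (xs i) (P (i + 1)) (xs (i + 1))"
proof -
  obtain u where u: "awalk u W u" using t by (auto simp: is_tour_def)
  obtain D e where D: "D \<in> cycles T" "e \<in> D" using cycles_nonempty_cycle_tree cycles_nonempty by blast
  then have "W \<noteq> []" using tour_count_cycle[OF t D] by auto
  then have "\<not> apath u W u" using apath_nonempty_ends by blast
  then obtain A S B v where W: "W = A @ S @ B" "awalk v S v" "S \<noteq> []" "distinct (tl (awalk_verts v S))"
    using first_closed_subwalk[OF u] by metis
  have S: "traversal v S" by (rule closed_subwalk_traversal[of A S B]) (use t W in simp_all)
  define R where "R = B @ A"
  have rot: "rotate (length A) W = S @ R" using W(1) by (simp add: rotate_append R_def)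
  have tour: "is_tour (S @ R)" using tour_rotate[of A "S @ B"] t W(1) by (simp add: R_def)
  then obtain w where "awalk w (S @ R) w" unfolding is_tour_def by blast
  then have R: "awalk v R v" using awalk_ends[OF W(2), of w "awlast w S"] W(3) by auto
  have Scyc: "walk_edges S \<in> cycles T" using S end_block_cyclesD(1) by (simp add: traversal_def)
  have "R \<noteq> []"
  proof
    assume "R = []"
    obtain g b where "g \<in> edges T" "g \<notin> walk_edges S"
      using IV_edge_off_cycle[OF traversal_IV[OF S] Scyc] by metis
    then show False using tour_edges[OF tour] \<open>R = []\<close> by simp
  qed
  obtain k xs C P where K: "C 0 = S" "xs 0 = v" "xs (k + 1) = v"
    "S @ R = concat (map (\<lambda>i. C i @ P (i + 1)) [0..<k + 1])"
    "\<forall>i\<le>k. apath (xs i) (P (i + 1)) (xs (i + 1))"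
    "\<forall>i. 1 \<le> i \<and> i \<le> k \<longrightarrow> traversal (xs i) (C i)"
    using tour_decomposition_aux[of S R "[]" v v S] tour R by auto
  \<comment> \<open>Otherwise \<open>R\<close> would be a simple path from \<open>v\<close> to
    \<open>v\<close>, hence empty.\<close>
  have "k \<ge> 1"
  proof (rule ccontr)
    assume "\<not> k \<ge> 1"
    then have "k = 0" by simp
    then have "apath v (P 1) v" "R = P 1" using K by auto
    then show False using apath_nonempty_ends \<open>R \<noteq> []\<close> by blast
  qed
  \<comment> \<open>\<open>tour_decomposition_aux\<close> says nothing about
    \<open>C (k + 1)\<close>; setting it to \<open>S\<close> makes the indices cyclic.\<close>
  define C' where "C' = C(k + 1 := S)"
  show thesis
  proof (rule that[of k C' xs "length A" P])
    show "C' (k + 1) = C' 0" "xs (k + 1) = xs 0" using K by (simp_all add: C'_def)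
    have eq: "map (\<lambda>i. C i @ P (i + 1)) [0..<k + 1] = map (\<lambda>i. C' i @ P (i + 1)) [0..<k + 1]"
      by (rule map_cong) (auto simp: C'_def)
    show "rotate (length A) W = concat (map (\<lambda>i. C' i @ P (i + 1)) [0..<k + 1])"
      unfolding rot K(4) eq ..
    show "traversal (xs i) (C' i)" if "i \<le> k + 1" for i
      using K S that by (cases "i = 0"; cases "i = k + 1") (auto simp: C'_def)
    show "apath (xs i) (P (i + 1)) (xs (i + 1))" if "i \<le> k" for i using K(5) that by simp
  qed fact
qed

text \<open>
  A maximal run of the path inside \<open>D\<close> would begin and end at the only intersection vertex on \<open>D\<close>.
\<close>

lemma apath_avoids_end_block:
  assumes D: "D \<in> end_block_cycles T \<P>" and p: "apath a p b" and ab: "a \<in> IV" "b \<in> IV"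
  shows "D \<inter> walk_edges p = {}"
proof (rule ccontr)
  assume "D \<inter> walk_edges p \<noteq> {}"
  then obtain d where d: "d \<in> set p" "fst d \<in> D" by (auto simp: walk_edges_def)
  note Dc = end_block_cyclesD(1)[OF D]
  let ?in = "\<lambda>d. fst d \<in> D"
  define A where "A = takeWhile (\<lambda>d. \<not> ?in d) p"
  define q where "q = dropWhile (\<lambda>d. \<not> ?in d) p"
  define M where "M = takeWhile ?in q"
  define B where "B = dropWhile ?in q"
  have pq: "p = A @ q" "q = M @ B" by (simp_all add: A_def q_def M_def B_def)
  have "q \<noteq> []" using d by (auto simp: q_def dropWhile_eq_Nil_conv)
  then have "?in (hd q)" unfolding q_def using hd_dropWhile[of "\<lambda>d. \<not> ?in d" p] by blast
  then have M: "M \<noteq> []" "\<forall>d\<in>set M. ?in d" using \<open>q \<noteq> []\<close>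
    by (cases q; auto simp: M_def dest: set_takeWhileD)+
  define s t where "s = awlast a A" and "t = awlast s M"
  have As: "awalk a A s" and Mt: "apath s M t" and Bb: "awalk t B b"
    using p unfolding pq s_def t_def by (auto simp: apath_append_iff awalkI_apath)
  have "ends T (walk_edges M) \<subseteq> ends T D" by (rule ends_mono) (use M(2) in \<open>auto simp: walk_edges_def\<close>)
  moreover have "s \<in> ends T (walk_edges M)" "t \<in> ends T (walk_edges M)"
    using path_nodes_eq_ends[OF awalkI_apath[OF Mt] M(1)] hd_in_awalk_verts(2)[OF Mt]
      awalk_last_in_awalk_verts[OF awalkI_apath[OF Mt]] by auto
  ultimately have st: "s \<in> ends T D" "t \<in> ends T D" by auto
  \<comment> \<open>Either the run starts with the path, at \<open>a\<close>, or the dart before it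
    is off \<open>D\<close> and ends at \<open>s\<close>.\<close>
  have "s \<in> IV"
  proof (cases "A = []")
    case True
    then show ?thesis using ab by (simp add: s_def)
  next
    case False
    then obtain A' f where f: "A = A' @ [f]" by (meson rev_exhaust)
    have "\<not> ?in f" using set_takeWhileD[of f "\<lambda>d. \<not> ?in d" p] f by (simp add: A_def)
    moreover have "fst f \<in> edges T" "endpt T (fst f) (\<not> snd f) = s" using As f by (auto simp: awalk_simps)
    ultimately show ?thesis using cycle_leaves_at_IV[OF Dc st(1)] by blast
  qed
  moreover have "t \<in> IV"
  proof (cases B)
    case Nil
    then show ?thesis using ab Bb by (simp add: awalk_Nil_iff)
  next
    case (Cons f B')
    have "\<not> ?in f" using Cons unfolding B_def by (simp add: dropWhile_eq_Cons_conv)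
    moreover have "fst f \<in> edges T" "endpt T (fst f) (snd f) = t" using Bb Cons by (auto simp: awalk_Cons_iff)
    ultimately show ?thesis using cycle_leaves_at_IV[OF Dc st(2)] by blast
  qed
  ultimately have "s = t" using st end_block_cyclesD(2)[OF D] by (metis IntI singletonD)
  then show False using apath_nonempty_ends[OF Mt M(1)] by simp
qed

text \<open>Identities between indicators thus become counts of edges in the tour. Outside of
  \<open>T\<close> both sides are zero.\<close>

lemma edge_indicator_tour:
  assumes t: "is_tour W"
  shows "edge_indicator T \<P> e = int (count_list (map fst W) e)"
proof (cases "e \<in> edges T")
  case True
  then show ?thesis
  proof (rule edges_cases)
    fix C assume C: "C \<in> cycles T" "e \<in> C"
    then show ?thesis using tour_count_cycle[OF t C] by (auto simp: edge_indicator_def)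
  next
    fix Q assume Q: "Q \<in> \<P>" "e \<in> path_edges Q"
    then have "\<not> (\<exists>C\<in>cycles T. e \<in> C)" using cycle_path_disjoint by blast
    then show ?thesis using tour_count_path[OF t Q] Q unfolding edge_indicator_def by auto
  qed
next
  case False
  then have "e \<notin> walk_edges W" using tour_edges[OF t] by simp
  then have "count_list (map fst W) e = 0" by (simp add: count_list_0_iff walk_edges_def)
  moreover have "\<not> (\<exists>C\<in>cycles T. e \<in> C)" "\<not> (\<exists>Q\<in>\<P>. e \<in> path_edges Q)"
    using False cycle_tree_unfold(5) by blast+
  ultimately show ?thesis by (simp add: edge_indicator_def)
qed

end

section \<open>The pieces of the decomposed tour and their properties\<close>

locale decomposed_tour = noncircuit_cycle_tree T \<P> \<epsilon>
  for T :: "('v, 'e) sgraph" and \<P> :: "('v, 'e) bpath set" and \<epsilon> +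
  fixes k :: nat and x :: "nat \<Rightarrow> 'v" and C P :: "nat \<Rightarrow> ('e \<times> bool) list"
  assumes k: "k \<ge> 1"
    and closed: "C (k + 1) = C 0" "x (k + 1) = x 0"
    and tour: "is_tour (concat (map (\<lambda>i. C i @ P (i + 1)) [0..<k + 1]))"
    and traversals: "\<And>i. i \<le> k + 1 \<Longrightarrow> traversal (x i) (C i)"
    and paths: "\<And>i. i \<le> k \<Longrightarrow> simple_path T (x i) (P (i + 1)) (x (i + 1))"
begin

abbreviation W :: "('e \<times> bool) list" where
  "W \<equiv> concat (map (\<lambda>i. C i @ P (i + 1)) [0..<k + 1])"

lemma end_block: "i \<le> k + 1 \<Longrightarrow> walk_edges (C i) \<in> end_block_cycles T \<P>"
  and cycle: "i \<le> k + 1 \<Longrightarrow> walk_edges (C i) \<in> cycles T"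
  and IV_cycle: "i \<le> k + 1 \<Longrightarrow> ends T (walk_edges (C i)) \<inter> IV = {x i}"
  and x_IV: "i \<le> k + 1 \<Longrightarrow> x i \<in> IV"
  using traversals[of i] end_block_cyclesD(1) by (auto simp: traversal_def)

text \<open>No edge repeats inside one piece, so the multiplicity of an edge in \<open>W\<close> is
  the number of pieces that contain it.\<close>

lemma count_W:
  "count_list (map fst W) e =
     (\<Sum>i\<le>k. of_bool (e \<in> walk_edges (C i))) + (\<Sum>i\<le>k. of_bool (e \<in> walk_edges (P (i + 1))))"
proof -
  have "count_list (map fst W) e =
      (\<Sum>i<k + 1. count_list (map fst (C i)) e + count_list (map fst (P (i + 1))) e)"
    unfolding count_list_concat_upt by simp
  also have "\<dots> = (\<Sum>i<k + 1. of_bool (e \<in> walk_edges (C i)) + of_bool (e \<in> walk_edges (P (i + 1))))"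
  proof (rule sum.cong)
    fix i assume "i \<in> {..<k + 1}"
    then have "distinct (map fst (C i))" "distinct (map fst (P (i + 1)))"
      using traversals[of i] apath_distinct_edges[OF paths[of i]] by (auto simp: traversal_def)
    then show "count_list (map fst (C i)) e + count_list (map fst (P (i + 1))) e =
        of_bool (e \<in> walk_edges (C i)) + of_bool (e \<in> walk_edges (P (i + 1)))"
      by (simp only: count_list_distinct set_map_fst_eq_walk_edges)
  qed simp
  finally show ?thesis by (simp add: sum.distrib lessThan_Suc_atMost)
qed

lemma path_avoids_end_blocks:
  "D \<in> end_block_cycles T \<P> \<Longrightarrow> i \<le> k \<Longrightarrow> D \<inter> walk_edges (P (i + 1)) = {}"
  by (rule apath_avoids_end_block[OF _ paths]) (auto intro: x_IV)

lemma card_eq_sum_paths: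
  "card {i \<in> {1..k + 1}. e \<in> walk_edges (P i)} = (\<Sum>i\<le>k. of_bool (e \<in> walk_edges (P (i + 1))))"
proof -
  have "(\<Sum>i\<le>k. of_bool (e \<in> walk_edges (P (i + 1)))) = (\<Sum>i=1..k + 1. of_bool (e \<in> walk_edges (P i)) :: nat)"
    by (rule sum.reindex_bij_witness[of _ "\<lambda>i. i - 1" "\<lambda>i. i + 1"]) auto
  moreover have "{i \<in> {1..k + 1}. e \<in> walk_edges (P i)} = {1..k + 1} \<inter> {i. e \<in> walk_edges (P i)}"
    by auto
  ultimately show ?thesis by (simp only: sum_of_bool_eq finite_atLeastAtMost of_nat_id)
qed

text \<open>If one cycle appeared at two indices, the tour would use each of its edges at least
  twice.\<close>

lemma inj: "inj_on (\<lambda>i. walk_edges (C i)) {0..k}"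
proof (rule inj_onI)
  fix i j assume ij: "i \<in> {0..k}" "j \<in> {0..k}" "walk_edges (C i) = walk_edges (C j)"
  show "i = j"
  proof (rule ccontr)
    assume "i \<noteq> j"
    have "walk_edges (C i) \<noteq> {}" by (rule cycles_nonempty[OF cycle]) (use ij in simp)
    then obtain e where e: "e \<in> walk_edges (C i)" by blast
    have "(2::nat) = (\<Sum>l\<in>{i, j}. of_bool (e \<in> walk_edges (C l)))" using \<open>i \<noteq> j\<close> e ij by simp
    also have "\<dots> \<le> (\<Sum>l\<le>k. of_bool (e \<in> walk_edges (C l)))" by (rule sum_mono2) (use ij in auto)
    also have "\<dots> \<le> count_list (map fst W) e" unfolding count_W by simp
    also have "\<dots> = 1" using tour_count_cycle[OF tour cycle[of i] e] ij by simp
    finally show False by simp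
  qed
qed

text \<open>An edge of an end-block cycle is used once by the tour but by none of the paths, so some
  \<open>C i\<close> contains it; cycles with a common edge are equal.\<close>

lemma bij: "bij_betw (\<lambda>i. walk_edges (C i)) {0..k} (end_block_cycles T \<P>)"
proof (rule bij_betw_imageI[OF inj])
  show "(\<lambda>i. walk_edges (C i)) ` {0..k} = end_block_cycles T \<P>"
  proof
    show "(\<lambda>i. walk_edges (C i)) ` {0..k} \<subseteq> end_block_cycles T \<P>" using end_block by auto
    show "end_block_cycles T \<P> \<subseteq> (\<lambda>i. walk_edges (C i)) ` {0..k}"
    proof
      fix D assume D: "D \<in> end_block_cycles T \<P>"
      note Dc = end_block_cyclesD(1)[OF D]
      obtain e where e: "e \<in> D" using cycles_nonempty[OF Dc] by blast
      have "(\<Sum>i\<le>k. of_bool (e \<in> walk_edges (P (i + 1)))) = (0::nat)"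
        using path_avoids_end_blocks[OF D] e by (intro sum.neutral) auto
      then have "(\<Sum>i\<le>k. of_bool (e \<in> walk_edges (C i))) \<noteq> (0::nat)"
        using tour_count_cycle[OF tour Dc e] unfolding count_W by simp
      then obtain i where i: "i \<le> k" "e \<in> walk_edges (C i)" by (auto split: if_splits)
      then have "D = walk_edges (C i)" using cycles_eqI[OF Dc cycle[of i] e] by simp
      then show "D \<in> (\<lambda>i. walk_edges (C i)) ` {0..k}" using i by auto
    qed
  qed
qed

text \<open>None of the \<open>C i\<close> contains \<open>e\<close>, so the paths account for its
  whole multiplicity in the tour.\<close>

lemma count_paths_non_end_block:
  assumes "\<And>D. D \<in> end_block_cycles T \<P> \<Longrightarrow> e \<notin> D"
  shows "card {i \<in> {1..k + 1}. e \<in> walk_edges (P i)} = count_list (map fst W) e"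
proof -
  have "(\<Sum>i\<le>k. of_bool (e \<in> walk_edges (C i))) = (0::nat)"
    using assms end_block by (intro sum.neutral) auto
  then show ?thesis unfolding card_eq_sum_paths count_W by simp
qed

lemma neighbours_disjoint:
  assumes "i \<le> k"
  shows "ends T (walk_edges (C i)) \<inter> ends T (walk_edges (C (i + 1))) = {}"
proof -
  have "walk_edges (C i) \<noteq> walk_edges (C (i + 1))"
  proof (cases "i = k")
    \<comment> \<open>The successor of \<open>C k\<close> is \<open>C 0\<close>, which runs around a
      different cycle because \<open>k \<ge> 1\<close>.\<close>
    case True
    then show ?thesis using inj_onD[OF inj, of k 0] k closed(1) by auto
  next
    case False
    then show ?thesis using inj_onD[OF inj, of i "i + 1"] assms by auto
  qed
  then show ?thesis using end_block_cycles_disjoint[OF end_block end_block, of i "i + 1"] assms by simp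
qed

text \<open>An empty path would make the base points of two disjoint cycles equal.\<close>

lemma path_nonempty:
  assumes "i \<le> k"
  shows "P (i + 1) \<noteq> []"
proof
  assume "P (i + 1) = []"
  then have "x i = x (i + 1)" using paths[OF assms] by (simp add: apath_Nil_iff)
  then show False using neighbours_disjoint[OF assms] IV_cycle[of i] IV_cycle[of "i + 1"] assms by auto
qed

text \<open>The path has no edge on the cycle, so a common vertex has an edge off the cycle and is
  an intersection vertex; \<open>x j\<close> is the only one on \<open>C j\<close>.\<close>

lemma path_meets_end_block:
  assumes "i \<le> k" "j = i \<or> j = i + 1"
  shows "ends T (walk_edges (C j)) \<inter> ends T (walk_edges (P (i + 1))) = {x j}"
proof
  note p = paths[OF assms(1)] and ne = path_nonempty[OF assms(1)]
  have jk: "j \<le> k + 1" using assms by auto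
  have "x j \<in> ends T (walk_edges (P (i + 1)))"
    using path_nodes_eq_ends[OF awalkI_apath[OF p] ne] hd_in_awalk_verts(2)[OF p]
      awalk_last_in_awalk_verts[OF awalkI_apath[OF p]] assms(2) by auto
  then show "{x j} \<subseteq> ends T (walk_edges (C j)) \<inter> ends T (walk_edges (P (i + 1)))"
    using IV_cycle[OF jk] by auto
  show "ends T (walk_edges (C j)) \<inter> ends T (walk_edges (P (i + 1))) \<subseteq> {x j}"
  proof
    fix v assume "v \<in> ends T (walk_edges (C j)) \<inter> ends T (walk_edges (P (i + 1)))"
    then have v: "v \<in> ends T (walk_edges (C j))" "v \<in> ends T (walk_edges (P (i + 1)))" by auto
    obtain e b where e: "e \<in> walk_edges (P (i + 1))" "endpt T e b = v" using v(2) by (rule endsE)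
    have "e \<in> edges T" using e(1) awalk_edges[OF awalkI_apath[OF p]] by blast
    moreover have "e \<notin> walk_edges (C j)" using path_avoids_end_blocks[OF end_block[OF jk] assms(1)] e(1) by blast
    ultimately have "v \<in> IV" using cycle_leaves_at_IV[OF cycle[OF jk] v(1) _ e(2)] by blast
    then show "v \<in> {x j}" using v(1) IV_cycle[OF jk] by blast
  qed
qed

lemma dumbbell:
  assumes "i \<le> k"
  shows "dumbbell T (x i) (x (i + 1)) (C i) (P (i + 1)) (C (i + 1))"
proof
  have t: "traversal (x i) (C i)" "traversal (x (i + 1)) (C (i + 1))" using traversals assms by auto
  then show "awalk (x i) (C i) (x i)" "distinct (tl (awalk_verts (x i) (C i)))" "C i \<noteq> []" "distinct (map fst (C i))"
    "awalk (x (i + 1)) (C (i + 1)) (x (i + 1))" "distinct (tl (awalk_verts (x (i + 1)) (C (i + 1))))"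
    "C (i + 1) \<noteq> []" "distinct (map fst (C (i + 1)))"
    by (simp_all add: traversal_def)
  show "\<not> balanced T (walk_edges (C i))" "\<not> balanced T (walk_edges (C (i + 1)))"
    using end_block_cyclesD(3)[OF end_block] assms by auto
  show "apath (x i) (P (i + 1)) (x (i + 1))" "P (i + 1) \<noteq> []"
    "ends T (walk_edges (C i)) \<inter> ends T (walk_edges (C (i + 1))) = {}"
    using paths path_nonempty neighbours_disjoint assms by simp_all
  show "ends T (walk_edges (C i)) \<inter> ends T (walk_edges (P (i + 1))) = {x i}"
    "ends T (walk_edges (C (i + 1))) \<inter> ends T (walk_edges (P (i + 1))) = {x (i + 1)}"
    using path_meets_end_block[OF assms] by blast+
  show "B = B'" if "B \<in> cycles T" "B' \<in> cycles T" "e \<in> B" "e \<in> B'" for B B' e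
    using that by (rule cycles_eqI)
qed

text \<open>A rotation moves the three pieces of one circuit to the front, so that consecutive darts
  among them are consecutive in a tour. For \<open>i = k\<close> the third piece is the first one of
  \<open>W\<close>, since \<open>C (k + 1) = C 0\<close>.\<close>

lemma segment_tour:
  assumes "i \<le> k"
  obtains B where "is_tour (C i @ P (i + 1) @ C (i + 1) @ B)"
proof (cases "i = k")
  case True
  have "[0..<k + 1] = 0 # [1..<k] @ [k]" using k upt_conv_Cons[of 0 k] by simp
  then have W: "W = (C 0 @ P 1 @ concat (map (\<lambda>i. C i @ P (i + 1)) [1..<k])) @ (C k @ P (k + 1))" by simp
  have "is_tour ((C k @ P (k + 1)) @ (C 0 @ P 1 @ concat (map (\<lambda>i. C i @ P (i + 1)) [1..<k])))"
    by (rule tour_rotate[OF tour[unfolded W]])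
  then show thesis using that True closed(1) by simp
next
  case False
  then have "i < k" using assms by simp
  have "[0..<k + 1] = [0..<i] @ [i..<k + 1]"
    using upt_add_eq_append[of 0 i "k + 1 - i"] assms by (simp del: upt_Suc)
  also have "[i..<k + 1] = i # (i + 1) # [i + 2..<k + 1]"
    using upt_conv_Cons[of i "k + 1"] upt_conv_Cons[of "i + 1" "k + 1"] \<open>i < k\<close> by (simp del: upt_Suc)
  finally have "[0..<k + 1] = [0..<i] @ i # (i + 1) # [i + 2..<k + 1]" .
  then have W: "W = concat (map (\<lambda>i. C i @ P (i + 1)) [0..<i]) @
      (C i @ P (i + 1) @ C (i + 1) @ P (i + 2) @ concat (map (\<lambda>i. C i @ P (i + 1)) [i + 2..<k + 1]))" by (simp del: upt_Suc)
  have "is_tour ((C i @ P (i + 1) @ C (i + 1) @ P (i + 2) @ concat (map (\<lambda>i. C i @ P (i + 1)) [i + 2..<k + 1])) @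
      concat (map (\<lambda>i. C i @ P (i + 1)) [0..<i]))"
    by (rule tour_rotate[OF tour[unfolded W]])
  then show thesis using that by simp
qed

text \<open>On the path, ends included, the tour passes through \<open>v\<close> inside the circuit,
  so its arriving and departing half-edges have different values. At the remaining vertices of the
  two cycles every edge of \<open>T\<close> lies on the cycle, so both values occur there as they do
  in \<open>T\<close>. The sink or source at a base point is inherited too, because base points are
  cut-points of \<open>T\<close>.\<close>

lemma directed_type_III:
  assumes i: "i \<le> k"
  shows "directed_type_III_circuit T (walk_edges (C i)) (x i, P (i + 1)) (walk_edges (C (i + 1))) \<epsilon>"
proof -
  interpret dumbbell T "x i" "x (i + 1)" "C i" "P (i + 1)" "C (i + 1)" by (rule dumbbell[OF i])
  have sink: "sink T (walk_edges (C j)) \<epsilon> (x j) \<or> source T (walk_edges (C j)) \<epsilon> (x j)" if "j \<le> k + 1" for j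
    using direction cycle[OF that] IV_cycle[OF that] IV_cut_point[OF x_IV[OF that]]
    unfolding direction_def by blast
  have "Defs.direction H \<epsilon>"
  proof (rule direction_H)
    show "orientation T \<epsilon>" using direction by (simp add: direction_def)
    show "sink T (walk_edges (C i)) \<epsilon> (x i) \<or> source T (walk_edges (C i)) \<epsilon> (x i)"
      "sink T (walk_edges (C (i + 1))) \<epsilon> (x (i + 1)) \<or> source T (walk_edges (C (i + 1))) \<epsilon> (x (i + 1))"
      using sink i by auto
    fix v assume v: "v \<in> ends T F"
    show "\<exists>h k. fst h \<in> F \<and> fst k \<in> F \<and> endpt T (fst h) (snd h) = v \<and>
      endpt T (fst k) (snd k) = v \<and> \<epsilon> (fst h) (snd h) \<noteq> \<epsilon> (fst k) (snd k)"
    proof (cases "v \<in> ends T (walk_edges (P (i + 1)))")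
      case True
      then have "v \<in> set (awalk_verts (x i) (P (i + 1)))" unfolding verts_eq_ends .
      then obtain p1 p2 where p12: "P (i + 1) = p1 @ p2" "awalk (x i) p1 v" "awalk v p2 (x (i + 1))"
        using awalk_decomp[OF awalkI_apath[OF p(1)]] by blast
      obtain B where B: "is_tour (C i @ P (i + 1) @ C (i + 1) @ B)" using segment_tour[OF i] by metis
      have L: "awalk (x i) (C i @ p1) v" "awalk v (p2 @ C (i + 1)) (x (i + 1))"
        using awalk_appendI[OF c(1) p12(2)] awalk_appendI[OF p12(3) d(1)] .
      \<comment> \<open>The darts just before and just after \<open>v\<close>. Both exist even if
        \<open>v\<close> is an end of the path, since \<open>C i\<close> and
        \<open>C (i + 1)\<close> are nonempty.\<close>
      obtain L1 h where L1: "C i @ p1 = L1 @ [h]" using c(3) by (metis append_is_Nil_conv rev_exhaust)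
      obtain k' L2 where L2: "p2 @ C (i + 1) = k' # L2" using d(3) by (metis append_is_Nil_conv list.exhaust)
      have eq: "C i @ P (i + 1) @ C (i + 1) @ B = L1 @ [h] @ (k' # L2) @ B"
        unfolding p12(1) L2[symmetric] by (simp add: L1[symmetric, simplified append_assoc] flip: append_assoc L1)
      have "is_tour ([] @ L1 @ [h, k'] @ L2 @ B)" using B unfolding eq by simp
      from tour_consecutive[OF this] have "is_tour (h # k' # L2 @ B @ L1)" by simp
      then have "\<epsilon> (fst h) (\<not> snd h) \<noteq> \<epsilon> (fst k') (snd k')" by (rule tour_coherent)
      moreover have "endpt T (fst h) (\<not> snd h) = v" "endpt T (fst k') (snd k') = v"
        using L unfolding L1 L2 by (auto simp: awalk_simps)
      moreover have "fst h \<in> F" "fst k' \<in> F"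
      proof -
        have "h \<in> set (C i @ p1)" "k' \<in> set (p2 @ C (i + 1))" unfolding L1 L2 by auto
        then show "fst h \<in> F" "fst k' \<in> F" unfolding p12(1) by (auto simp: walk_edges_def)
      qed
      ultimately show ?thesis by (intro exI[of _ "dart_rev h"] exI[of _ k']) simp
    next
      case False
      then obtain j where j: "j \<le> k + 1" "v \<in> ends T (walk_edges (C j))" "walk_edges (C j) \<subseteq> F" "v \<noteq> x j"
      proof -
        from v False consider "v \<in> ends T (walk_edges (C i))" | "v \<in> ends T (walk_edges (C (i + 1)))"
          unfolding ends_Un by blast
        then show thesis
        proof cases
          case 1
          show thesis by (rule that[OF _ 1]) (use i False x_in(2) in auto)
        next
          case 2
          show thesis by (rule that[OF _ 2]) (use i False y_in(2) in auto)
        qed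
      qed
      have "v \<notin> IV" using j IV_cycle[OF j(1)] by blast
      then have all: "e \<in> walk_edges (C j)" if "e \<in> edges T" "endpt T e b = v" for e b
        using cycle_leaves_at_IV[OF cycle[OF j(1)] j(2) that] by blast
      obtain e b where e: "e \<in> walk_edges (C j)" "endpt T e b = v" using j(2) by (rule endsE)
      have "e \<in> edges T" using e(1) cycles_subset[OF cycle[OF j(1)]] by blast
      then obtain h where h: "fst h \<in> edges T" "endpt T (fst h) (snd h) = v" "\<epsilon> (fst h) (snd h) \<noteq> \<epsilon> e b"
        using opposite_half_edge[OF direction, of "(e, b)" v] e(2) by auto
      then show ?thesis using e j(3) all[OF h(1,2)] by (intro exI[of _ h] exI[of _ "(e, b)"]) auto
    qed
  qed
  then show ?thesis using type_III unfolding directed_type_III_circuit_def H_def by blast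
qed

text \<open>
  Both sides count how often the tour uses \<open>e\<close>: every \<open>C i\<close> belongs to two circuits with weight
  \<open>1\<close>, and every \<open>P (i + 1)\<close> to one circuit with weight \<open>2\<close>.
\<close>

lemma edge_indicator_sum:
  "of_int (edge_indicator T \<P> e) = (1 / 2 :: rat) * (\<Sum>i=0..k. of_int (edge_indicator
     (cpc_graph T (walk_edges (C i)) (x i, P (i + 1)) (walk_edges (C (i + 1)))) {(x i, P (i + 1))} e))"
proof -
  let ?c = "\<lambda>i. of_bool (e \<in> walk_edges (C i)) :: int"
  let ?p = "\<lambda>i. of_bool (e \<in> walk_edges (P (i + 1))) :: int"
  have "(\<Sum>i=0..k. edge_indicator
      (cpc_graph T (walk_edges (C i)) (x i, P (i + 1)) (walk_edges (C (i + 1)))) {(x i, P (i + 1))} e) =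
      (\<Sum>i=0..k. ?c i + ?c (i + 1) + 2 * ?p i)"
  proof (rule sum.cong)
    fix i assume "i \<in> {0..k}"
    then have i: "i \<le> k" by simp
    interpret d: dumbbell T "x i" "x (i + 1)" "C i" "P (i + 1)" "C (i + 1)" by (rule dumbbell[OF i])
    show "edge_indicator
      (cpc_graph T (walk_edges (C i)) (x i, P (i + 1)) (walk_edges (C (i + 1)))) {(x i, P (i + 1))} e =
      ?c i + ?c (i + 1) + 2 * ?p i"
      using d.edge_indicator_H[of e] unfolding d.H_def .
  qed simp
  also have "\<dots> = (\<Sum>i\<le>k. ?c i) + (\<Sum>i\<le>k. ?c (i + 1)) + 2 * (\<Sum>i\<le>k. ?p i)"
    by (simp add: sum.distrib sum_distrib_left atLeast0AtMost)
  \<comment> \<open>A cyclic shift of the indices, closed up by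
    \<open>C (k + 1) = C 0\<close>.\<close>
  also have "(\<Sum>i\<le>k. ?c (i + 1)) = (\<Sum>i\<le>k. ?c i)"
  proof -
    have "(\<Sum>i\<le>k. ?c i) + ?c (k + 1) = ?c 0 + (\<Sum>i\<le>k. ?c (i + 1))"
      using sum.atMost_Suc[of ?c k] sum.atMost_Suc_shift[of ?c k] by simp
    then show ?thesis using closed(1) by simp
  qed
  also have "(\<Sum>i\<le>k. ?c i) + (\<Sum>i\<le>k. ?c i) + 2 * (\<Sum>i\<le>k. ?p i) = 2 * edge_indicator T \<P> e"
    unfolding edge_indicator_tour[OF tour] count_W by simp
  finally have "of_int (\<Sum>i=0..k. edge_indicator
      (cpc_graph T (walk_edges (C i)) (x i, P (i + 1)) (walk_edges (C (i + 1)))) {(x i, P (i + 1))} e) =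
      (of_int (2 * edge_indicator T \<P> e) :: rat)" by (rule arg_cong)
  then show ?thesis by (simp only: of_int_sum of_int_mult)
qed

end

text \<open>A closed walk given as a list starts somewhere, possibly in the middle of a piece, so a
  rotation of \<open>W\<close> is decomposed.\<close>

theorem theorem3p8:
  fixes G T :: "('v, 'e) sgraph"
    and \<P> :: "('v, 'e) bpath set"
    and \<epsilon> :: "'e \<Rightarrow> bool \<Rightarrow> int"
    and W :: "('e \<times> bool) list"
  assumes "signed_graph G"
    and "signed_subgraph T G"
    and "eulerian_cycle_tree T \<P>"
    and "direction T \<epsilon>"
    and "\<exists>u. walk T u W u"
    and "\<forall>C\<in>cycles T. \<forall>e\<in>C. count_list (map fst W) e = 1"
    and "\<forall>Q\<in>\<P>. \<forall>e\<in>path_edges Q. count_list (map fst W) e = 2"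
    and "\<not> circuit T \<P>"
  shows "\<exists>(k::nat) (m::nat) (x :: nat \<Rightarrow> 'v)
           (C :: nat \<Rightarrow> ('e \<times> bool) list) (P :: nat \<Rightarrow> ('e \<times> bool) list).
      k \<ge> 1 \<and> C (k + 1) = C 0 \<and> x (k + 1) = x 0 \<and>
      rotate m W = concat (map (\<lambda>i. C i @ P (i + 1)) [0..<k + 1]) \<and>
      \<comment> \<open>(i)\<close>
      (\<forall>i\<le>k. walk T (x i) (C i) (x i) \<and> simple_closed_path T (C i)) \<and>
      bij_betw (\<lambda>i. walk_edges (C i)) {0..k} (end_block_cycles T \<P>) \<and>
      (\<forall>i\<le>k. simple_path T (x i) (P (i + 1)) (x (i + 1)) \<and> P (i + 1) \<noteq> []) \<and>
      \<comment> \<open>(ii)\<close>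
      (\<forall>D\<in>cycles T - end_block_cycles T \<P>. \<forall>e\<in>D.
         card {i\<in>{1..k + 1}. e \<in> walk_edges (P i)} = 1) \<and>
      (\<forall>Q\<in>\<P>. \<forall>e\<in>path_edges Q.
         card {i\<in>{1..k + 1}. e \<in> walk_edges (P i)} = 2) \<and>
      \<comment> \<open>(iii)\<close>
      (\<forall>i\<le>k. directed_type_III_circuit T
         (walk_edges (C i)) (x i, P (i + 1)) (walk_edges (C (i + 1))) \<epsilon>) \<and>
      \<comment> \<open>(iv)\<close>
      (\<forall>e\<in>edges G. of_int (edge_indicator T \<P> e) =
         (1 / 2 :: rat) * (\<Sum>i=0..k. of_int (edge_indicator
            (cpc_graph T (walk_edges (C i)) (x i, P (i + 1)) (walk_edges (C (i + 1))))
            {(x i, P (i + 1))} e)))"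
proof -
  interpret noncircuit_cycle_tree T \<P> \<epsilon>
    using assms by unfold_locales (auto simp: eulerian_cycle_tree_def)
  have t: "is_tour W" using assms(5-7) by (simp add: is_tour_def)
  obtain k C x m P where dec: "k \<ge> 1" "C (k + 1) = C 0" "x (k + 1) = x 0"
    "rotate m W = concat (map (\<lambda>i. C i @ P (i + 1)) [0..<k + 1])"
    "\<And>i. i \<le> k + 1 \<Longrightarrow> traversal (x i) (C i)"
    "\<And>i. i \<le> k \<Longrightarrow> apath (x i) (P (i + 1)) (x (i + 1))"
    by (rule tour_decomposition[OF t]) (rule that; assumption)
  have "is_tour (rotate m W)"
    unfolding rotate_drop_take by (rule tour_rotate) (simp add: t)
  then interpret decomposed_tour T \<P> \<epsilon> k x C P
    using dec by unfold_locales auto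
  have traverse: "\<forall>i\<le>k. walk T (x i) (C i) (x i) \<and> simple_closed_path T (C i)"
  proof (intro allI impI conjI)
    fix i assume "i \<le> k"
    then have "traversal (x i) (C i)" using dec(5) by simp
    then show "walk T (x i) (C i) (x i)" "simple_closed_path T (C i)"
      using simple_closed_pathI[of "x i" "C i"] by (simp_all add: traversal_def)
  qed
  have path: "\<forall>i\<le>k. simple_path T (x i) (P (i + 1)) (x (i + 1)) \<and> P (i + 1) \<noteq> []"
    using dec(6) path_nonempty by blast
  have cycle_once: "\<forall>D\<in>cycles T - end_block_cycles T \<P>. \<forall>e\<in>D.
      card {i\<in>{1..k + 1}. e \<in> walk_edges (P i)} = 1"
  proof (intro ballI)
    fix D e assume D: "D \<in> cycles T - end_block_cycles T \<P>" "e \<in> D"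
    then have "e \<notin> E" if "E \<in> end_block_cycles T \<P>" for E
      using cycles_eqI[OF end_block_cyclesD(1)[OF that], of D e] that by blast
    then show "card {i\<in>{1..k + 1}. e \<in> walk_edges (P i)} = 1"
      using count_paths_non_end_block[of e] tour_count_cycle[OF tour, of D e] D by simp
  qed
  have path_twice: "\<forall>Q\<in>\<P>. \<forall>e\<in>path_edges Q.
      card {i\<in>{1..k + 1}. e \<in> walk_edges (P i)} = 2"
  proof (intro ballI)
    fix Q e assume Q: "Q \<in> \<P>" "e \<in> path_edges Q"
    then have "e \<notin> E" if "E \<in> end_block_cycles T \<P>" for E
      using cycle_path_disjoint[OF end_block_cyclesD(1)[OF that] Q(1) _ Q(2)] by blast
    then show "card {i\<in>{1..k + 1}. e \<in> walk_edges (P i)} = 2"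
      using count_paths_non_end_block[of e] tour_count_path[OF tour Q] by simp
  qed
  have directed: "\<forall>i\<le>k. directed_type_III_circuit T
      (walk_edges (C i)) (x i, P (i + 1)) (walk_edges (C (i + 1))) \<epsilon>"
    by (intro allI impI) (rule directed_type_III)
  have indicator: "\<forall>e\<in>edges G. of_int (edge_indicator T \<P> e) =
      (1 / 2 :: rat) * (\<Sum>i=0..k. of_int (edge_indicator
        (cpc_graph T (walk_edges (C i)) (x i, P (i + 1)) (walk_edges (C (i + 1)))) {(x i, P (i + 1))} e))"
    by (intro ballI) (rule edge_indicator_sum)
  show ?thesis
    by (rule exI[of _ k], rule exI[of _ m], rule exI[of _ x], rule exI[of _ C], rule exI[of _ P],
      intro conjI) (fact dec(1-4) traverse bij path cycle_once path_twice directed indicator)+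
qed

end
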